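(* Let $k$ be an algebraically closed field of characteristic zero, $V$ a finite-dimensional $k$-vector space, $G = \mathrm{GL}(V)$, and let $I$ be a graded ideal of the graded algebra $\bigoplus_{m\ge 0} S^m V^* \cong k[x_1,\dots,x_n]$, where $\{x_1,\dots,x_n\}$ is a fixed basis of $V^*$. There exists a Zariski open dense subscheme $U \subset G$ such that the Gröbner fan $GF(g.I)$ is the same for all $g \in U$.
   Context: $G$ acts naturally on $\bigoplus_m S^mV^*$ by graded algebra automorphisms. For $w \in \mathbb R^n$, $\prec_w$ denotes the weight order on monomials corresponding to $w$, with the lexicographic order used for tie-breaking, and $\mathrm{in}_{\prec_w} J$ denotes the initial ideal of a graded ideal $J$ with respect to $\prec_w$. Define an equivalence relation on $\mathbb R^n$ (depending on $J$) by $w \sim w'$ if $\mathrm{in}_{\prec_w}J = \mathrm{in}_{\prec_{w'}}J$; let $[w]$ be the equivalence class of $w$ and $\overline{[w]}$ its closure in $\mathbb R^n$. The Gröbner fan $GF(J)$ is the collection of all the closures $\overline{[w]}$, $w \in \mathbb R^n$. *)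

theory Defs
  imports
    "HOL-Analysis.Analysis"
    "HOL-Algebra.Ideal"
    "HOL-Library.Poly_Mapping"
    "HOL-Library.Function_Algebras"
    "HOL-Computational_Algebra.Polynomial"
begin

section \<open>The general linear group with its Zariski topology\<close>

definition dual :: "('k::field \<Rightarrow> 'v::ab_group_add \<Rightarrow> 'v) \<Rightarrow> ('v \<Rightarrow> 'k) set" where
  "dual smul = {\<xi>. Vector_Spaces.linear smul (*) \<xi>}"

definition dual_scale :: "'k::field \<Rightarrow> ('v \<Rightarrow> 'k) \<Rightarrow> 'v \<Rightarrow> 'k" where
  "dual_scale c \<xi> = (\<lambda>v. c * \<xi> v)"

definition basis_of_dual ::
    "('k::field \<Rightarrow> 'v::ab_group_add \<Rightarrow> 'v) \<Rightarrow> nat \<Rightarrow> (nat \<Rightarrow> 'v \<Rightarrow> 'k) \<Rightarrow> bool" where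
  "basis_of_dual smul n x \<longleftrightarrow>
     inj_on x {..<n} \<and> \<not> module.dependent dual_scale (x ` {..<n}) \<and>
     module.span dual_scale (x ` {..<n}) = dual smul"

definition GL :: "('k::field \<Rightarrow> 'v::ab_group_add \<Rightarrow> 'v) \<Rightarrow> ('v \<Rightarrow> 'v) set" where
  "GL smul = {g. Vector_Spaces.linear smul smul g \<and> bij g}"

text \<open>
  Polynomial functions on the affine space of endomorphisms of \<open>V\<close>. The functions
  \<open>g \<mapsto> \<xi> (g v)\<close> are the linear combinations of matrix entries, so no basis is needed.
\<close>

inductive_set polynomial_functions ::
    "('k::field \<Rightarrow> 'v::ab_group_add \<Rightarrow> 'v) \<Rightarrow> (('v \<Rightarrow> 'v) \<Rightarrow> 'k) set"
  for smul :: "'k::field \<Rightarrow> 'v::ab_group_add \<Rightarrow> 'v" where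
  const: "(\<lambda>g. c) \<in> polynomial_functions smul"
| entry: "\<xi> \<in> dual smul \<Longrightarrow> (\<lambda>g. \<xi> (g v)) \<in> polynomial_functions smul"
| add: "p \<in> polynomial_functions smul \<Longrightarrow> q \<in> polynomial_functions smul \<Longrightarrow>
    (\<lambda>g. p g + q g) \<in> polynomial_functions smul"
| mult: "p \<in> polynomial_functions smul \<Longrightarrow> q \<in> polynomial_functions smul \<Longrightarrow>
    (\<lambda>g. p g * q g) \<in> polynomial_functions smul"

text \<open>
  \<open>GL(V)\<close> is a principal open subset of the space of endomorphisms, so the sets where a
  polynomial function does not vanish are a basis of its Zariski topology; regular functions
  with a power of the determinant in the denominator give no further open sets.
  Over an algebraically closed field, open subschemes of \<open>GL(V)\<close> are the same as open sets
  of closed points.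
\<close>

definition zariski_GL :: "('k::field \<Rightarrow> 'v::ab_group_add \<Rightarrow> 'v) \<Rightarrow> ('v \<Rightarrow> 'v) topology" where
  "zariski_GL smul =
     topology_generated_by {{g \<in> GL smul. p g \<noteq> 0} | p. p \<in> polynomial_functions smul}"

lemma topspace_zariski_GL:
  fixes smul :: "'k::field \<Rightarrow> 'v::ab_group_add \<Rightarrow> 'v"
  shows "topspace (zariski_GL smul) = GL smul"
proof -
  let ?B = "{{g \<in> GL smul. p g \<noteq> 0} | p. p \<in> polynomial_functions smul}"
  have "{g \<in> GL smul. (\<lambda>g. 1::'k) g \<noteq> 0} \<in> ?B"
    by (rule CollectI, rule exI[of _ "\<lambda>g. 1"]) (simp add: polynomial_functions.const)
  then have "GL smul \<subseteq> \<Union> ?B"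
    by (intro Union_upper) simp
  moreover have "\<Union> ?B \<subseteq> GL smul"
    by (rule Union_least) clarsimp
  ultimately show ?thesis
    unfolding zariski_GL_def topology_generated_by_topspace by (rule equalityI[rotated])
qed


section \<open>The polynomial ring and its graded ideals\<close>

text \<open>
  The variables \<open>x\<^sub>1, \<dots>, x\<^sub>n\<close> have the indices \<open>0, \<dots>, n - 1\<close>.
\<close>

type_synonym monomial = "nat \<Rightarrow>\<^sub>0 nat"
type_synonym 'k mpoly = "monomial \<Rightarrow>\<^sub>0 'k"

definition polys :: "nat \<Rightarrow> ('k::field) mpoly set" where
  "polys n = {f. \<forall>m\<in>Poly_Mapping.keys f. Poly_Mapping.keys m \<subseteq> {..<n}}"

definition poly_ring :: "nat \<Rightarrow> ('k::field) mpoly ring" where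
  "poly_ring n = \<lparr>carrier = polys n, mult = (*), one = 1, zero = 0, add = (+)\<rparr>"

lemma polys_plus: "f \<in> polys n \<Longrightarrow> g \<in> polys n \<Longrightarrow> f + g \<in> polys n"
  using Poly_Mapping.keys_add[of f g] by (auto simp: polys_def)

lemma polys_times:
  assumes "f \<in> polys n" "g \<in> polys n"
  shows "f * g \<in> polys n"
  unfolding polys_def
proof (intro CollectI ballI)
  fix m assume "m \<in> Poly_Mapping.keys (f * g)"
  then obtain a b where "m = a + b" "a \<in> Poly_Mapping.keys f" "b \<in> Poly_Mapping.keys g"
    using keys_mult[of f g] by blast
  then show "Poly_Mapping.keys m \<subseteq> {..<n}"
    using assms Poly_Mapping.keys_add[of a b] unfolding polys_def by blast
qed

lemma polys_uminus: "f \<in> polys n \<Longrightarrow> - f \<in> polys n"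
  by (simp add: polys_def)

lemma cring_poly_ring: "cring (poly_ring n :: ('k::field) mpoly ring)"
proof (rule cringI)
  show "abelian_group (poly_ring n :: 'k mpoly ring)"
  proof (rule abelian_groupI)
    fix f :: "'k mpoly"
    assume f: "f \<in> carrier (poly_ring n)"
    show "\<exists>g\<in>carrier (poly_ring n). g \<oplus>\<^bsub>poly_ring n\<^esub> f = \<zero>\<^bsub>poly_ring n\<^esub>"
      by (rule bexI[of _ "- f"]) (use f in \<open>auto simp: poly_ring_def polys_uminus\<close>)
  qed (auto simp: poly_ring_def polys_plus ac_simps, simp add: polys_def)
  show "comm_monoid (poly_ring n :: 'k mpoly ring)"
    by unfold_locales (auto simp: poly_ring_def polys_times ac_simps, simp add: polys_def)
qed (auto simp: poly_ring_def algebra_simps)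

definition total_degree :: "monomial \<Rightarrow> nat" where
  "total_degree m = (\<Sum>i\<in>Poly_Mapping.keys m. Poly_Mapping.lookup m i)"

definition homogeneous_component :: "nat \<Rightarrow> ('k::field) mpoly \<Rightarrow> 'k mpoly" where
  "homogeneous_component d f =
     (\<Sum>m\<in>{m \<in> Poly_Mapping.keys f. total_degree m = d}.
        Poly_Mapping.single m (Poly_Mapping.lookup f m))"

definition graded_ideal :: "nat \<Rightarrow> ('k::field) mpoly set \<Rightarrow> bool" where
  "graded_ideal n J \<longleftrightarrow>
     ideal J (poly_ring n) \<and> (\<forall>f\<in>J. \<forall>d. homogeneous_component d f \<in> J)"


section \<open>The action of \<open>GL(V)\<close> on polynomials\<close>

text \<open>
  The identification of the dual space with the space of linear forms in the variables,
  through coordinates with respect to the basis \<open>x 0, \<dots>, x (n - 1)\<close>.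
\<close>

definition linear_form :: "nat \<Rightarrow> (nat \<Rightarrow> 'v \<Rightarrow> 'k::field) \<Rightarrow> ('v \<Rightarrow> 'k) \<Rightarrow> 'k mpoly" where
  "linear_form n x \<xi> =
     (\<Sum>i<n. Poly_Mapping.single (Poly_Mapping.single i 1)
              (module.representation dual_scale (x ` {..<n}) \<xi> (x i)))"

definition poly_subst :: "(nat \<Rightarrow> ('k::field) mpoly) \<Rightarrow> 'k mpoly \<Rightarrow> 'k mpoly" where
  "poly_subst \<sigma> f =
     (\<Sum>m\<in>Poly_Mapping.keys f. Poly_Mapping.single 0 (Poly_Mapping.lookup f m) *
        (\<Prod>i\<in>Poly_Mapping.keys m. \<sigma> i ^ Poly_Mapping.lookup m i))"

text \<open>
  \<open>g\<close> acts on the dual space by the contragredient representation \<open>\<xi> \<mapsto> \<xi> \<circ> g\<^sup>-\<^sup>1\<close>, and on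
  polynomials by the algebra endomorphism extending it.
\<close>

definition GL_act ::
    "nat \<Rightarrow> (nat \<Rightarrow> 'v \<Rightarrow> 'k::field) \<Rightarrow> ('v \<Rightarrow> 'v) \<Rightarrow> 'k mpoly \<Rightarrow> 'k mpoly" where
  "GL_act n x g = poly_subst (\<lambda>j. linear_form n x (x j \<circ> inv_into UNIV g))"


section \<open>Initial ideals and the Groebner fan\<close>

definition weight :: "nat \<Rightarrow> (nat \<Rightarrow> real) \<Rightarrow> monomial \<Rightarrow> real" where
  "weight n w m = (\<Sum>i<n. w i * real (Poly_Mapping.lookup m i))"

text \<open>
  The order \<open><\<close> of the library on monomials is the lexicographic one in which the variable
  with the smallest index is the largest.
\<close>

definition weight_less :: "nat \<Rightarrow> (nat \<Rightarrow> real) \<Rightarrow> monomial \<Rightarrow> monomial \<Rightarrow> bool" where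
  "weight_less n w m m' \<longleftrightarrow>
     weight n w m < weight n w m' \<or> weight n w m = weight n w m' \<and> m < m'"

lemma monomial_less_iff:
  fixes m m' :: monomial
  shows "m < m' \<longleftrightarrow> (\<exists>k. Poly_Mapping.lookup m k < Poly_Mapping.lookup m' k \<and>
           (\<forall>i<k. Poly_Mapping.lookup m i = Poly_Mapping.lookup m' i))"
  by (simp add: less_poly_mapping.rep_eq less_fun_def)

text \<open>The initial monomial is the largest one (it exists, see below, unless \<open>f = 0\<close>).\<close>

definition initial_monomial :: "nat \<Rightarrow> (nat \<Rightarrow> real) \<Rightarrow> ('k::field) mpoly \<Rightarrow> monomial" where
  "initial_monomial n w f =
     (THE m. m \<in> Poly_Mapping.keys f \<and>
        (\<forall>m'\<in>Poly_Mapping.keys f. m' \<noteq> m \<longrightarrow> weight_less n w m' m))"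

lemma ex1_initial_monomial:
  fixes f :: "('k::field) mpoly"
  assumes "f \<noteq> 0"
  shows "\<exists>!m. m \<in> Poly_Mapping.keys f \<and>
           (\<forall>m'\<in>Poly_Mapping.keys f. m' \<noteq> m \<longrightarrow> weight_less n w m' m)"
proof (rule ex_ex1I)
  define K where "K = Poly_Mapping.keys f"
  have K: "finite K" "K \<noteq> {}" using assms by (auto simp: K_def)
  define M where "M = {m \<in> K. weight n w m = Max (weight n w ` K)}"
  have "Max (weight n w ` K) \<in> weight n w ` K" using K by (intro Max_in) auto
  then obtain m where "m \<in> K" "Max (weight n w ` K) = weight n w m" by (rule imageE)
  then have "m \<in> M" by (simp add: M_def)
  then have M: "finite M" "M \<noteq> {}" using K(1) by (auto simp: M_def)
  have "M \<subseteq> K" by (auto simp: M_def)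
  have "Max M \<in> M" using M by (rule Max_in)
  have *: "weight_less n w m' (Max M)" if "m' \<in> K" "m' \<noteq> Max M" for m'
  proof -
    have le: "weight n w m' \<le> Max (weight n w ` K)" using K that by auto
    have "m' < Max M" if "weight n w m' = Max (weight n w ` K)"
      using that \<open>m' \<in> K\<close> \<open>m' \<noteq> Max M\<close> M(1) by (simp add: M_def order.strict_iff_order)
    then show ?thesis using le \<open>Max M \<in> M\<close> by (auto simp: weight_less_def M_def)
  qed
  have "Max M \<in> K" using \<open>Max M \<in> M\<close> \<open>M \<subseteq> K\<close> by (rule subsetD[rotated])
  show "\<exists>m. m \<in> Poly_Mapping.keys f \<and>
      (\<forall>m'\<in>Poly_Mapping.keys f. m' \<noteq> m \<longrightarrow> weight_less n w m' m)"
    unfolding K_def[symmetric]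
    by (intro exI[of _ "Max M"] conjI ballI impI * \<open>Max M \<in> K\<close>)
next
  fix a b
  assume a: "a \<in> Poly_Mapping.keys f \<and>
      (\<forall>m'\<in>Poly_Mapping.keys f. m' \<noteq> a \<longrightarrow> weight_less n w m' a)"
    and b: "b \<in> Poly_Mapping.keys f \<and>
      (\<forall>m'\<in>Poly_Mapping.keys f. m' \<noteq> b \<longrightarrow> weight_less n w m' b)"
  show "a = b"
  proof (rule ccontr)
    assume neq: "a \<noteq> b"
    have "weight_less n w a b"
      by (rule b[THEN conjunct2, THEN bspec, THEN mp]) (rule a[THEN conjunct1], rule neq)
    moreover have "weight_less n w b a"
      by (rule a[THEN conjunct2, THEN bspec, THEN mp]) (rule b[THEN conjunct1], rule neq[symmetric])
    ultimately have "a < b \<and> b < a" unfolding weight_less_def by linarith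
    then show False using less_asym[of a b] by simp
  qed
qed

definition initial_ideal :: "nat \<Rightarrow> (nat \<Rightarrow> real) \<Rightarrow> ('k::field) mpoly set \<Rightarrow> 'k mpoly set" where
  "initial_ideal n w J =
     genideal (poly_ring n) {Poly_Mapping.single (initial_monomial n w f) 1 | f. f \<in> J \<and> f \<noteq> 0}"

text \<open>
  \<open>Euclidean_space n\<close> is the library's \<open>\<real>\<^sup>n\<close>: its points are the functions \<open>nat \<Rightarrow> real\<close> that
  vanish at all indices \<open>i \<ge> n\<close>.
\<close>

definition weight_class :: "nat \<Rightarrow> ('k::field) mpoly set \<Rightarrow> (nat \<Rightarrow> real) \<Rightarrow> (nat \<Rightarrow> real) set" where
  "weight_class n J w =
     {w' \<in> topspace (Euclidean_space n). initial_ideal n w' J = initial_ideal n w J}"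

definition groebner_fan :: "nat \<Rightarrow> ('k::field) mpoly set \<Rightarrow> (nat \<Rightarrow> real) set set" where
  "groebner_fan n J =
     {Euclidean_space n closure_of weight_class n J w | w. w \<in> topspace (Euclidean_space n)}"

end

theory Submission
  imports Defs "Jordan_Normal_Form.Determinant"
begin

text \<open>
  Fix a weight \<open>w\<close> and write \<open>J\<^sub>g\<close> for the translate of \<open>I\<close> by \<open>g\<close>. The initial ideal of \<open>J\<^sub>g\<close> is
  generated by the set of its initial monomials, so it suffices to find an open dense \<open>U\<close> such
  that, for every \<open>w\<close>, this set is the same for all \<open>g\<close> in \<open>U\<close>. There are infinitely many degrees
  and infinitely many weights to control, and \<open>U\<close> must work for all of them at once.

  \<^emph>\<open>All weights at once.\<close> Call a set \<open>A\<close> of monomials of degree \<open>d\<close> free if the only element of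
  \<open>J\<^sub>g\<close> supported on \<open>A\<close> is \<open>0\<close>. The free sets are the independent sets of a matroid, namely of
  the images of the monomials in the quotient by \<open>J\<^sub>g\<close>, and do not involve \<open>w\<close>. The monomials
  that are not initial form the basis that the greedy algorithm finds when it runs through the
  monomials in increasing order (\<open>standard_iff_free\<close>). Hence the free sets of degree \<open>d\<close>
  determine the initial monomials of degree \<open>d\<close> for every weight
  (\<open>initial_monomials_determined_by_free\<close>).

  \<^emph>\<open>One degree.\<close> Whether \<open>A\<close> is free for \<open>g\<close> can be tested before translating: pull the monomials
  in \<open>A\<close> back along \<open>g\<close> and ask whether they are linearly independent modulo \<open>I\<close>. The
  coefficients of the pullbacks are polynomial in the entries of \<open>g\<close>, so this condition is open: if
  it holds for \<open>g\<close>, some determinant is nonzero at \<open>g\<close> and freeness holds wherever that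
  determinant is nonzero (\<open>free_polynomial\<close>). Since \<open>GL(V)\<close> is irreducible
  (\<open>GL_irreducible\<close>), finitely many such determinants are simultaneously nonzero on an open dense
  set, and there the free sets are exactly those that are free for at least one group element.

  \<^emph>\<open>All degrees at once.\<close> The number of initial monomials of degree \<open>d\<close> is the dimension of
  the degree \<open>d\<close> part of \<open>I\<close>, whatever \<open>g\<close> and \<open>w\<close> are (\<open>card_initial_monomials\<close>,
  \<open>translate_hilbert_function\<close>). Monomial ideals with one common Hilbert function are determined by
  their monomials up to a common degree bound \<open>D\<close>
  (\<open>upsets_determined_in_bounded_degree\<close>). So only the finitely many sets \<open>A\<close> of degree at
  most \<open>D\<close> matter.
\<close>

section \<open>Monomial ideals with a given Hilbert function\<close>

definition mons :: "nat \<Rightarrow> nat \<Rightarrow> monomial set" where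
  "mons n d = {m. Poly_Mapping.keys m \<subseteq> {..<n} \<and> total_degree m = d}"

text \<open>
  These are the sets of monomials contained in a monomial ideal of the ring in \<open>n\<close> variables.
\<close>

definition monomial_upset :: "nat \<Rightarrow> monomial set \<Rightarrow> bool" where
  "monomial_upset n N \<longleftrightarrow> N \<subseteq> (\<Union>d. mons n d) \<and>
     (\<forall>a\<in>N. \<forall>b. Poly_Mapping.keys b \<subseteq> {..<n} \<longrightarrow> a + b \<in> N)"

lemma total_degree_eq_sum:
  assumes "Poly_Mapping.keys m \<subseteq> {..<n}"
  shows "total_degree m = (\<Sum>i<n. Poly_Mapping.lookup m i)"
  unfolding total_degree_def
  using assms by (intro sum.mono_neutral_left) (auto simp: in_keys_iff)

lemma total_degree_add: "total_degree (a + b) = total_degree a + total_degree b"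
proof -
  obtain n where n: "Poly_Mapping.keys a \<union> Poly_Mapping.keys b \<subseteq> {..<n}"
    using finite_nat_iff_bounded[of "Poly_Mapping.keys a \<union> Poly_Mapping.keys b"] by auto
  moreover have "Poly_Mapping.keys (a + b) \<subseteq> {..<n}"
    using n Poly_Mapping.keys_add[of a b] by blast
  ultimately show ?thesis
    by (simp add: total_degree_eq_sum[of _ n] lookup_add sum.distrib)
qed

lemma finite_mons: "finite (mons n d)"
proof -
  have "Poly_Mapping.lookup ` mons n d \<subseteq> {f. \<forall>i. (i \<in> {..<n} \<longrightarrow> f i \<in> {..d}) \<and> (i \<notin> {..<n} \<longrightarrow> f i = 0)}"
  proof (intro image_subsetI CollectI conjI allI impI)
    fix m i assume m: "m \<in> mons n d"
    show "Poly_Mapping.lookup m i \<in> {..d}" if "i \<in> {..<n}"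
      using that m member_le_sum[of i "{..<n}" "Poly_Mapping.lookup m"] total_degree_eq_sum[of m n]
      by (simp add: mons_def)
    show "Poly_Mapping.lookup m i = 0" if "i \<notin> {..<n}"
      using that m by (auto simp: mons_def in_keys_iff)
  qed
  moreover have "finite {f. \<forall>i. (i \<in> {..<n} \<longrightarrow> f i \<in> {..d}) \<and> (i \<notin> {..<n} \<longrightarrow> f i = (0::nat))}"
    by (rule finite_set_of_finite_funs) auto
  ultimately have "finite (Poly_Mapping.lookup ` mons n d)"
    by (rule finite_subset)
  then show ?thesis
    by (rule finite_imageD) (intro inj_onI poly_mapping_eqI, simp)
qed

text \<open>
  Every sequence has a monotone subsequence, and a decreasing sequence of natural numbers is constant
  from the point on where it attains its minimum.
\<close>

lemma nat_seq_has_incseq: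
  fixes s :: "nat \<Rightarrow> nat"
  shows "\<exists>r. strict_mono r \<and> incseq (s \<circ> r)"
proof -
  obtain r where r: "strict_mono r" "monoseq (\<lambda>k. s (r k))"
    using seq_monosub by blast
  show ?thesis
  proof (cases "incseq (\<lambda>k. s (r k))")
    case True
    then show ?thesis using r(1) by (auto simp: o_def)
  next
    case False
    then have dec: "decseq (\<lambda>k. s (r k))"
      using r(2) by (simp add: monoseq_iff)
    obtain k0 where k0: "\<And>k. s (r k0) \<le> s (r k)"
      using ex_has_least_nat[of "\<lambda>_. True" undefined "\<lambda>k. s (r k)"] by auto
    have "s (r (k0 + k)) = s (r k0)" for k
      using k0[of "k0 + k"] dec by (intro antisym) (auto simp: decseq_def)
    moreover have "strict_mono (\<lambda>k. r (k0 + k))"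
      using r(1) by (simp add: strict_mono_def)
    ultimately show ?thesis
      by (intro exI[of _ "\<lambda>k. r (k0 + k)"]) (simp add: o_def incseq_def)
  qed
qed

text \<open>
  Dickson's lemma in sequence form: refine the subsequence for one coordinate after another.
\<close>

lemma dickson_subsequence:
  fixes s :: "nat \<Rightarrow> nat \<Rightarrow> nat"
  shows "\<exists>r. strict_mono r \<and> (\<forall>i<n. incseq (\<lambda>k. s (r k) i))"
proof (induction n)
  case 0
  show ?case by (intro exI[of _ "\<lambda>k. k"]) (simp add: strict_mono_def)
next
  case (Suc n)
  then obtain r where r: "strict_mono r" "\<forall>i<n. incseq (\<lambda>k. s (r k) i)" by blast
  obtain q where q: "strict_mono q" "incseq ((\<lambda>k. s (r k) n) \<circ> q)"
    using nat_seq_has_incseq by blast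
  have "incseq (\<lambda>k. s (r (q k)) i)" if "i < Suc n" for i
    using that r(2) q by (cases "i = n") (auto simp: incseq_def o_def strict_mono_less_eq)
  moreover have "strict_mono (\<lambda>k. r (q k))"
    using r(1) q(1) by (simp add: strict_mono_def)
  ultimately show ?case by blast
qed

text \<open>
  If no degree bound worked, one could choose for every \<open>D\<close> a counterexample \<open>s D\<close> that is not a
  multiple of an element of degree at most \<open>D\<close>. Along a subsequence that increases in every
  coordinate, the first member divides all later ones, in particular one whose index exceeds the
  degree of the first member.
\<close>

lemma dickson_bounded_generators:
  assumes "\<And>m. m \<in> N \<Longrightarrow> Poly_Mapping.keys m \<subseteq> {..<n}"
  shows "\<exists>D. \<forall>m\<in>N. \<exists>a\<in>N. \<exists>b.
    total_degree a \<le> D \<and> Poly_Mapping.keys b \<subseteq> {..<n} \<and> m = a + b"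
proof (rule ccontr)
  let ?R = "\<lambda>D m. \<exists>a\<in>N. \<exists>b. total_degree a \<le> D \<and> Poly_Mapping.keys b \<subseteq> {..<n} \<and> m = a + b"
  assume "\<not> (\<exists>D. \<forall>m\<in>N. ?R D m)"
  then have "\<forall>D. \<exists>m. m \<in> N \<and> \<not> ?R D m" by (simp add: Bex_def)
  from choice[OF this] obtain s where "\<forall>D. s D \<in> N \<and> \<not> ?R D (s D)" ..
  then have s: "\<And>D. s D \<in> N" "\<And>D. \<not> ?R D (s D)" by simp_all
  obtain r where r: "strict_mono r" "\<forall>i<n. incseq (\<lambda>k. Poly_Mapping.lookup (s (r k)) i)"
    using dickson_subsequence[of n "\<lambda>k. Poly_Mapping.lookup (s k)"] by blast
  define k where "k = total_degree (s (r 0))"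
  have le: "Poly_Mapping.lookup (s (r 0)) i \<le> Poly_Mapping.lookup (s (r k)) i" for i
  proof (cases "i < n")
    case True then show ?thesis using r(2) by (simp add: incseq_def)
  next
    case False
    then have "i \<notin> Poly_Mapping.keys (s (r 0))" using assms[OF s(1)] by auto
    then show ?thesis by (simp add: in_keys_iff)
  qed
  have "s (r k) = s (r 0) + (s (r k) - s (r 0))"
    by (rule poly_mapping_eqI) (simp add: lookup_add lookup_minus le)
  moreover have "Poly_Mapping.keys (s (r k) - s (r 0)) \<subseteq> {..<n}"
    using assms[OF s(1)[of "r k"]] by (auto simp: in_keys_iff lookup_minus subset_iff)
  moreover have "total_degree (s (r 0)) \<le> r k"
    unfolding k_def[symmetric] using r(1) by (rule strict_mono_imp_increasing)
  ultimately have "?R (r k) (s (r k))" using s(1) by blast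
  then show False using s(2) by blast
qed

text \<open>
  A compactness argument. If no \<open>D\<close> worked, there would be pairs \<open>A D \<noteq> B D\<close> that agree up to
  degree \<open>D\<close>. Since there are only finitely many monomials of bounded degree, Koenig's lemma gives a
  limit \<open>L\<close> which agrees, up to any given degree, with infinitely many of the \<open>A D\<close>. Then
  \<open>L\<close> is generated up to some degree \<open>D\<^sub>0\<close> and has the common Hilbert function. Any member of the
  family that agrees with \<open>L\<close> up to \<open>D\<^sub>0\<close> contains \<open>L\<close>, hence equals it because both have equally
  many monomials in each degree. For suitable \<open>D \<ge> D\<^sub>0\<close> this applies to \<open>A D\<close> and to \<open>B D\<close>.
\<close>

lemma upsets_determined_in_bounded_degree:
  assumes up: "\<And>N. N \<in> F \<Longrightarrow> monomial_upset n N"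
    and hilbert: "\<And>N d. N \<in> F \<Longrightarrow> card (N \<inter> mons n d) = h d"
  shows "\<exists>D. \<forall>N\<in>F. \<forall>N'\<in>F.
    (\<forall>d\<le>D. N \<inter> mons n d = N' \<inter> mons n d) \<longrightarrow> N = N'"
proof (rule ccontr)
  assume "\<not> ?thesis"
  then have "\<forall>D. \<exists>NN. fst NN \<in> F \<and> snd NN \<in> F \<and>
      (\<forall>d\<le>D. fst NN \<inter> mons n d = snd NN \<inter> mons n d) \<and> fst NN \<noteq> snd NN"
    by (simp add: Bex_def)
  from choice[OF this] obtain AB where AB0:
    "\<forall>D. fst (AB D) \<in> F \<and> snd (AB D) \<in> F \<and>
      (\<forall>d\<le>D. fst (AB D) \<inter> mons n d = snd (AB D) \<inter> mons n d) \<and> fst (AB D) \<noteq> snd (AB D)" ..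
  define A B where "A D = fst (AB D)" and "B D = snd (AB D)" for D
  then have AB: "\<And>D. A D \<in> F" "\<And>D. B D \<in> F" "\<And>D. A D \<noteq> B D"
      "\<And>D d. d \<le> D \<Longrightarrow> A D \<inter> mons n d = B D \<inter> mons n d"
    using AB0 by (simp_all add: A_def B_def)
  define low where "low d = (\<Union>e\<le>d. mons n e)" for d
  have fin_low: "finite (low d)" for d by (simp add: low_def finite_mons)
  define S where "S d P = {D. A D \<inter> low d = P}" for d P
  \<comment> \<open>Koenig: a truncation shared by infinitely many \<open>A D\<close> extends to the next degree.\<close>
  have step: "\<exists>Q. infinite (S (Suc d) Q) \<and> Q \<inter> low d = P" if inf: "infinite (S d P)" for d P
  proof -
    have "(\<lambda>D. A D \<inter> low (Suc d)) ` S d P \<subseteq> Pow (low (Suc d))" by auto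
    then have "finite ((\<lambda>D. A D \<inter> low (Suc d)) ` S d P)"
      by (rule finite_subset) (simp add: fin_low)
    from pigeonhole_infinite[OF inf this] obtain D0 where D0: "D0 \<in> S d P"
        "infinite {D \<in> S d P. A D \<inter> low (Suc d) = A D0 \<inter> low (Suc d)}"
      by blast
    let ?Q = "A D0 \<inter> low (Suc d)"
    have "infinite (S (Suc d) ?Q)"
      by (rule infinite_super[OF _ D0(2)]) (auto simp: S_def)
    moreover have "?Q \<inter> low d = P"
    proof -
      have "low d \<subseteq> low (Suc d)" unfolding low_def by (intro UN_mono) auto
      then show ?thesis using D0(1) by (auto simp: S_def)
    qed
    ultimately show ?thesis by blast
  qed
  have start: "\<exists>P. infinite (S 0 P)"
  proof -
    have "(\<lambda>D. A D \<inter> low 0) ` UNIV \<subseteq> Pow (low 0)" by auto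
    then have "finite ((\<lambda>D. A D \<inter> low 0) ` UNIV)"
      by (rule finite_subset) (simp add: fin_low)
    from pigeonhole_infinite[OF infinite_UNIV_nat this] show ?thesis by (auto simp: S_def)
  qed
  obtain P where P: "\<And>d. infinite (S d (P d))" "\<And>d. P (Suc d) \<inter> low d = P d"
    using dependent_nat_choice[where P = "\<lambda>d Q. infinite (S d Q)" and Q = "\<lambda>d Q Q'. Q' \<inter> low d = Q",
        OF start step] by blast
  have low_mono: "low d \<subseteq> low e" if "d \<le> e" for d e
    unfolding low_def using that by (intro UN_mono) auto
  \<comment> \<open>The chosen truncations are restrictions of one another, so they glue to \<open>L\<close>.\<close>
  have P_restrict: "P (d + k) \<inter> low d = P d" for d k
  proof (induction k)
    case 0
    obtain D where "D \<in> S d (P d)" using P(1)[of d] infinite_imp_nonempty by blast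
    then show ?case by (auto simp: S_def)
  next
    case (Suc k)
    have "P (d + Suc k) \<inter> low d = P (Suc (d + k)) \<inter> low (d + k) \<inter> low d"
      using low_mono[of d "d + k"] by auto
    then show ?case using P(2)[of "d + k"] Suc by simp
  qed
  define L where "L = (\<Union>d. P d)"
  have L_low: "L \<inter> low d = P d" for d
  proof
    show "L \<inter> low d \<subseteq> P d"
    proof
      fix m assume "m \<in> L \<inter> low d"
      then obtain e where e: "m \<in> P e" "m \<in> low d" by (auto simp: L_def)
      show "m \<in> P d"
      proof (cases "e \<le> d")
        case True
        then show ?thesis using P_restrict[of e "d - e"] e by auto
      next
        case False
        then show ?thesis using P_restrict[of d "e - d"] e by auto
      qed
    qed
    show "P d \<subseteq> L \<inter> low d" using P_restrict[of d 0] by (auto simp: L_def)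
  qed
  have approx: "\<exists>D\<ge>e. A D \<inter> low d = L \<inter> low d" for d e
  proof -
    obtain D where "D \<ge> e" "D \<in> S d (P d)"
      using P(1)[of d] unfolding infinite_nat_iff_unbounded_le by blast
    then show ?thesis unfolding L_low S_def by blast
  qed
  have L_keys: "Poly_Mapping.keys m \<subseteq> {..<n}" if m: "m \<in> L" for m
  proof -
    obtain d where "m \<in> P d" using m by (auto simp: L_def)
    then have "m \<in> L \<inter> low d" by (simp only: L_low)
    then show ?thesis by (auto simp: low_def mons_def)
  qed
  have L_mons: "card (L \<inter> mons n d) = h d" for d
  proof -
    obtain D where D: "A D \<inter> low d = L \<inter> low d" using approx by blast
    have "mons n d \<subseteq> low d" by (auto simp: low_def)
    then have "L \<inter> mons n d = A D \<inter> mons n d" using D by blast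
    then show ?thesis using hilbert AB(1) by simp
  qed
  from dickson_bounded_generators[OF L_keys] obtain D0 where D0: "\<forall>m\<in>L.
      \<exists>a\<in>L. \<exists>b. total_degree a \<le> D0 \<and> Poly_Mapping.keys b \<subseteq> {..<n} \<and> m = a + b" ..
  have eq_L: "N = L" if N: "N \<in> F" and low: "N \<inter> low D0 = L \<inter> low D0" for N
  proof -
    have "L \<subseteq> N"
    proof
      fix m assume "m \<in> L"
      from bspec[OF D0 this] obtain a b
        where ab: "a \<in> L" "total_degree a \<le> D0" "Poly_Mapping.keys b \<subseteq> {..<n}" "m = a + b"
        by blast
      then have "a \<in> L \<inter> low D0" using L_keys[of a] by (simp add: low_def mons_def)
      then have "a \<in> N" using low by blast
      then show "m \<in> N" using up[OF N] ab by (auto simp: monomial_upset_def)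
    qed
    then have "L \<inter> mons n d = N \<inter> mons n d" for d
      by (intro card_subset_eq) (auto simp: finite_mons L_mons hilbert[OF N])
    then have "L \<inter> (\<Union>d. mons n d) = N \<inter> (\<Union>d. mons n d)"
      by (simp only: Int_UN_distrib)
    moreover have "L \<subseteq> (\<Union>d. mons n d)" "N \<subseteq> (\<Union>d. mons n d)"
      using L_keys up[OF N] by (auto simp: mons_def monomial_upset_def)
    ultimately show ?thesis by (simp only: Int_absorb2)
  qed
  obtain D where D: "D \<ge> D0" "A D \<inter> low D0 = L \<inter> low D0" using approx[of D0 D0] by blast
  have "B D \<inter> low D0 = A D \<inter> low D0"
    unfolding low_def Int_UN_distrib using AB(4)[of _ D] D(1) by (intro SUP_cong) auto
  then have "B D = L" using AB(2) D(2) by (intro eq_L) simp_all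
  moreover have "A D = L" using AB(1) D(2) by (rule eq_L)
  ultimately show False using AB(3) by blast
qed

section \<open>Polynomial functions and irreducibility of the general linear group\<close>

lemma polynomial_functions_sum:
  assumes "\<And>a. a \<in> A \<Longrightarrow> f a \<in> polynomial_functions smul"
  shows "(\<lambda>g. \<Sum>a\<in>A. f a g) \<in> polynomial_functions smul"
  using assms
proof (induction A rule: infinite_finite_induct)
  case (insert a A)
  then have "(\<lambda>g. f a g + (\<Sum>a\<in>A. f a g)) \<in> polynomial_functions smul"
    by (intro polynomial_functions.add) auto
  then show ?case using insert.hyps by simp
qed (simp_all add: polynomial_functions.const)

lemma polynomial_functions_prod:
  assumes "\<And>a. a \<in> A \<Longrightarrow> f a \<in> polynomial_functions smul"
  shows "(\<lambda>g. \<Prod>a\<in>A. f a g) \<in> polynomial_functions smul"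
  using assms
proof (induction A rule: infinite_finite_induct)
  case (insert a A)
  then have "(\<lambda>g. f a g * (\<Prod>a\<in>A. f a g)) \<in> polynomial_functions smul"
    by (intro polynomial_functions.mult) auto
  then show ?case using insert.hyps by simp
qed (simp_all add: polynomial_functions.const)

text \<open>
  The polynomial function is the determinant of the matrix \<open>c\<close>, after numbering the elements of \<open>A\<close>.
\<close>

lemma nonsingularity_polynomial:
  fixes c :: "'a \<Rightarrow> 'a \<Rightarrow> ('v::ab_group_add \<Rightarrow> 'v) \<Rightarrow> 'k::field"
  assumes fin: "finite A"
    and c: "\<And>a b. a \<in> A \<Longrightarrow> b \<in> A \<Longrightarrow> c a b \<in> polynomial_functions smul"
  shows "\<exists>p\<in>polynomial_functions smul. \<forall>g. p g \<noteq> 0 \<longleftrightarrow>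
    (\<forall>u. (\<forall>a\<in>A. (\<Sum>b\<in>A. c a b g * u b) = 0) \<longrightarrow> (\<forall>b\<in>A. u b = 0))"
proof -
  define N where "N = card A"
  obtain e where e: "bij_betw e {0..<N} A"
    using ex_bij_betw_nat_finite[OF fin] unfolding N_def by blast
  define M where "M g = mat N N (\<lambda>(i, j). c (e i) (e j) g)" for g
  have M: "M g \<in> carrier_mat N N" for g by (simp add: M_def)
  have eA: "e i \<in> A" if "i < N" for i using bij_betwE[OF e] that by simp
  define p where "p g = det (M g)" for g
  have "p g = (\<Sum>\<pi>\<in>{\<pi>. \<pi> permutes {0..<N}}. of_int (sign \<pi>) * (\<Prod>i\<in>{0..<N}. c (e i) (e (\<pi> i)) g))" for g
    unfolding p_def det_def'[OF M]
    by (intro sum.cong refl arg_cong2[where f = times] prod.cong)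
       (auto simp: M_def permutes_in_image)
  then have "p = (\<lambda>g. \<Sum>\<pi>\<in>{\<pi>. \<pi> permutes {0..<N}}. of_int (sign \<pi>) * (\<Prod>i\<in>{0..<N}. c (e i) (e (\<pi> i)) g))"
    by (rule ext)
  moreover have "\<dots> \<in> polynomial_functions smul"
    by (intro polynomial_functions_sum polynomial_functions.mult polynomial_functions.const
        polynomial_functions_prod c eA) (auto simp: permutes_in_image)
  ultimately have poly: "p \<in> polynomial_functions smul" by simp
  have kernel: "p g \<noteq> 0 \<longleftrightarrow>
    (\<forall>u. (\<forall>a\<in>A. (\<Sum>b\<in>A. c a b g * u b) = 0) \<longrightarrow> (\<forall>b\<in>A. u b = 0))" for g
  proof -
    have mult: "(M g *\<^sub>v vec N (\<lambda>j. u (e j))) $ i = (\<Sum>b\<in>A. c (e i) b g * u b)" if "i < N" for u i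
      using that by (simp add: M_def scalar_prod_def sum.reindex_bij_betw[OF e, symmetric])
    have zero: "M g *\<^sub>v vec N (\<lambda>j. u (e j)) = 0\<^sub>v N \<longleftrightarrow> (\<forall>a\<in>A. (\<Sum>b\<in>A. c a b g * u b) = 0)" for u
    proof -
      have "M g *\<^sub>v vec N (\<lambda>j. u (e j)) = 0\<^sub>v N \<longleftrightarrow>
          (\<forall>i<N. (M g *\<^sub>v vec N (\<lambda>j. u (e j))) $ i = 0)"
        using M[of g] by (auto simp: vec_eq_iff)
      also have "\<dots> \<longleftrightarrow> (\<forall>i\<in>{0..<N}. (\<Sum>b\<in>A. c (e i) b g * u b) = 0)"
        using mult by auto
      also have "\<dots> \<longleftrightarrow> (\<forall>a\<in>e ` {0..<N}. (\<Sum>b\<in>A. c a b g * u b) = 0)"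
        by simp
      finally show ?thesis unfolding bij_betw_imp_surj_on[OF e] .
    qed
    have nonzero: "vec N (\<lambda>j. u (e j)) \<noteq> 0\<^sub>v N \<longleftrightarrow> (\<exists>b\<in>A. u b \<noteq> 0)" for u :: "'a \<Rightarrow> 'k"
    proof -
      have "vec N (\<lambda>j. u (e j)) \<noteq> 0\<^sub>v N \<longleftrightarrow> (\<exists>b\<in>e ` {0..<N}. u b \<noteq> 0)"
        by (auto simp: vec_eq_iff)
      then show ?thesis unfolding bij_betw_imp_surj_on[OF e] .
    qed
    have ex_vec: "\<exists>u. v = vec N (\<lambda>j. u (e j))" if "v \<in> carrier_vec N" for v :: "'k vec"
      by (rule exI[of _ "\<lambda>a. v $ (inv_into {0..<N} e a)"])
         (use that e in \<open>auto simp: vec_eq_iff bij_betw_def inv_into_f_f\<close>)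
    have "p g = 0 \<longleftrightarrow> (\<exists>v. v \<in> carrier_vec N \<and> v \<noteq> 0\<^sub>v N \<and> M g *\<^sub>v v = 0\<^sub>v N)"
      unfolding p_def by (rule det_0_iff_vec_prod_zero_field[OF M])
    also have "\<dots> \<longleftrightarrow> (\<exists>u. vec N (\<lambda>j. u (e j)) \<noteq> 0\<^sub>v N \<and> M g *\<^sub>v vec N (\<lambda>j. u (e j)) = 0\<^sub>v N)"
      using ex_vec vec_carrier by metis
    finally show ?thesis unfolding zero nonzero by auto
  qed
  from poly kernel show ?thesis by blast
qed

text \<open>
  Restricting to lines reduces irreducibility to the fact that a nonzero polynomial in one variable
  has finitely many roots.
\<close>

lemma polynomial_function_on_line:
  fixes smul :: "'k::field \<Rightarrow> 'v::ab_group_add \<Rightarrow> 'v"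
  assumes "p \<in> polynomial_functions smul"
  shows "\<exists>P. \<forall>t. poly P t = p (\<lambda>v. smul (1 - t) (g v) + smul t (h v))"
  using assms
proof induction
  case (const c)
  show ?case by (rule exI[of _ "[:c:]"]) simp
next
  case (entry \<xi> v)
  then have \<xi>: "Vector_Spaces.linear smul (*) \<xi>" by (simp add: dual_def)
  show ?case
    by (rule exI[of _ "[:\<xi> (g v), \<xi> (h v) - \<xi> (g v):]"])
       (simp add: Vector_Spaces.linear.axioms(3) module_hom.add[OF Vector_Spaces.linear.axioms(3)[OF \<xi>]]
          module_hom.scale[OF Vector_Spaces.linear.axioms(3)[OF \<xi>]] algebra_simps)
next
  case (add p q)
  then obtain P Q where "\<forall>t. poly P t = p (\<lambda>v. smul (1 - t) (g v) + smul t (h v))"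
      "\<forall>t. poly Q t = q (\<lambda>v. smul (1 - t) (g v) + smul t (h v))" by blast
  then show ?case by (intro exI[of _ "P + Q"]) simp
next
  case (mult p q)
  then obtain P Q where "\<forall>t. poly P t = p (\<lambda>v. smul (1 - t) (g v) + smul t (h v))"
      "\<forall>t. poly Q t = q (\<lambda>v. smul (1 - t) (g v) + smul t (h v))" by blast
  then show ?case by (intro exI[of _ "P * Q"]) simp
qed

lemma vector_space_field: "vector_space ((*) :: 'k::field \<Rightarrow> 'k \<Rightarrow> 'k)"
  by unfold_locales (simp_all add: algebra_simps)

context finite_dimensional_vector_space
begin

text \<open>
  The functionals form the dual basis of the transformed basis \<open>g ` Basis\<close>.
\<close>

lemma dual_functionals:
  assumes g: "g \<in> GL scale"
  obtains \<phi> where "\<And>b. \<phi> b \<in> dual scale"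
    "\<And>b b'. b \<in> Basis \<Longrightarrow> b' \<in> Basis \<Longrightarrow> \<phi> b (g b') = (if b' = b then 1 else 0)"
proof -
  have lin: "Vector_Spaces.linear scale scale g" and bij: "bij g" using g by (auto simp: GL_def)
  interpret g: Vector_Spaces.linear scale scale g by (rule lin)
  interpret k: vector_space_pair scale "(*) :: 'a \<Rightarrow> 'a \<Rightarrow> 'a"
    by (intro vector_space_pair.intro vector_space_field) unfold_locales
  have inj: "inj g" using bij by (rule bij_is_inj)
  have ind: "independent (g ` Basis)"
    using g.independent_injective_image[OF independent_Basis inj_on_subset[OF inj subset_UNIV]] .
  have "\<exists>\<xi>. Vector_Spaces.linear scale (*) \<xi> \<and> (\<forall>v\<in>g ` Basis. \<xi> v = (if v = g b then 1 else 0))" for b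
    by (rule k.linear_independent_extend[OF ind])
  then obtain \<phi> where "\<And>b. Vector_Spaces.linear scale (*) (\<phi> b)"
      "\<And>b v. v \<in> g ` Basis \<Longrightarrow> \<phi> b v = (if v = g b then 1 else 0)" by metis
  with inj show ?thesis
    by (intro that[of \<phi>]) (auto simp: dual_def inj_eq)
qed

text \<open>
  Up to a nonzero factor this is the determinant; expressing \<open>l\<close> through the basis \<open>g ` Basis\<close> of the
  target turns \<open>g\<close> itself into the identity matrix.
\<close>

lemma invertibility_polynomial:
  assumes g: "g \<in> GL scale"
  shows "\<exists>p\<in>polynomial_functions scale. p g \<noteq> 0 \<and>
    (\<forall>l. Vector_Spaces.linear scale scale l \<longrightarrow> p l \<noteq> 0 \<longrightarrow> l \<in> GL scale)"
proof -
  obtain \<phi> where \<phi>: "\<And>b. \<phi> b \<in> dual scale"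
    "\<And>b b'. b \<in> Basis \<Longrightarrow> b' \<in> Basis \<Longrightarrow> \<phi> b (g b') = (if b' = b then 1 else 0)"
    using dual_functionals[OF g] by blast
  obtain p where p: "p \<in> polynomial_functions scale"
    "\<And>l. p l \<noteq> 0 \<longleftrightarrow> (\<forall>u. (\<forall>a\<in>Basis. (\<Sum>b\<in>Basis. \<phi> a (l b) * u b) = 0) \<longrightarrow> (\<forall>b\<in>Basis. u b = 0))"
    using nonsingularity_polynomial[OF finite_Basis, of "\<lambda>a b l. \<phi> a (l b)" scale]
      polynomial_functions.entry[OF \<phi>(1)] by auto
  have "p g \<noteq> 0"
    unfolding p(2) by (auto simp: \<phi>(2) finite_Basis if_distrib[of "\<lambda>x. x * _"] cong: if_cong)
  moreover have "l \<in> GL scale" if l: "Vector_Spaces.linear scale scale l" and pl: "p l \<noteq> 0" for l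
  proof -
    interpret l: Vector_Spaces.linear scale scale l by (rule l)
    have "v = 0" if v: "l v = 0" for v
    proof -
      have sum: "v = (\<Sum>b\<in>Basis. scale (representation Basis v b) b)"
        by (rule sum_representation_eq[symmetric]) (auto simp: independent_Basis span_Basis finite_Basis)
      have "(\<Sum>b\<in>Basis. \<phi> a (l b) * representation Basis v b) = 0" for a
      proof -
        interpret \<phi>: Vector_Spaces.linear scale "(*)" "\<phi> a" using \<phi>(1)[of a] by (simp add: dual_def)
        have "\<phi> a (l v) = (\<Sum>b\<in>Basis. \<phi> a (l b) * representation Basis v b)"
          by (subst (1) sum) (simp add: l.sum l.scale \<phi>.sum \<phi>.scale mult.commute)
        then show ?thesis using v by simp
      qed
      then have "\<forall>b\<in>Basis. representation Basis v b = 0" using pl unfolding p(2) by blast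
      then show ?thesis using sum by simp
    qed
    then have "inj l" by (simp add: l.inj_iff_eq_0)
    moreover from this have "surj l" by (rule linear_inj_imp_surj[OF l])
    ultimately show ?thesis using l by (simp add: GL_def bij_def)
  qed
  ultimately show ?thesis using p(1) by blast
qed

text \<open>
  On the line through \<open>g\<close> and \<open>h\<close>, each of the two given functions and a function that certifies
  invertibility restricts to a nonzero polynomial in the parameter \<open>t\<close>. Over an infinite field some
  \<open>t\<close> is a root of none of them.
\<close>

lemma GL_irreducible:
  assumes inf: "infinite (UNIV :: 'a set)"
    and p: "p \<in> polynomial_functions scale" "g \<in> GL scale" "p g \<noteq> 0"
    and q: "q \<in> polynomial_functions scale" "h \<in> GL scale" "q h \<noteq> 0"
  shows "\<exists>l\<in>GL scale. p l \<noteq> 0 \<and> q l \<noteq> 0"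
proof -
  obtain r where r: "r \<in> polynomial_functions scale" "r g \<noteq> 0"
    "\<And>l. Vector_Spaces.linear scale scale l \<Longrightarrow> r l \<noteq> 0 \<Longrightarrow> l \<in> GL scale"
    using invertibility_polynomial[OF p(2)] by blast
  define L where "L t = (\<lambda>v. scale (1 - t) (g v) + scale t (h v))" for t
  have L0: "L 0 = g" and L1: "L 1 = h" by (simp_all add: L_def)
  obtain P Q R where PQR: "\<And>t. poly P t = p (L t)" "\<And>t. poly Q t = q (L t)" "\<And>t. poly R t = r (L t)"
    using polynomial_function_on_line[OF p(1), of g h] polynomial_function_on_line[OF q(1), of g h]
      polynomial_function_on_line[OF r(1), of g h] unfolding L_def by auto
  have "poly P 0 \<noteq> 0" "poly Q 1 \<noteq> 0" "poly R 0 \<noteq> 0"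
    using p(3) q(3) r(2) by (simp_all add: PQR L0 L1)
  then have "P * Q * R \<noteq> 0" by auto
  then have "finite {t. poly (P * Q * R) t = 0}" by (rule poly_roots_finite)
  then obtain t where t: "poly (P * Q * R) t \<noteq> 0"
    using inf ex_new_if_finite[of "{t. poly (P * Q * R) t = 0}"] by auto
  have "Vector_Spaces.linear scale scale (L t)"
  proof -
    interpret g: Vector_Spaces.linear scale scale g using p(2) by (simp add: GL_def)
    interpret h: Vector_Spaces.linear scale scale h using q(2) by (simp add: GL_def)
    show ?thesis unfolding L_def
      by unfold_locales (simp_all add: g.add h.add g.scale h.scale algebra_simps)
  qed
  moreover have "r (L t) \<noteq> 0" "p (L t) \<noteq> 0" "q (L t) \<noteq> 0" using t by (simp_all add: PQR)
  ultimately show ?thesis using r(3) by blast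
qed

lemma GL_finite_product_nonzero:
  assumes inf: "infinite (UNIV :: 'a set)"
    and fin: "finite F" and F: "\<And>a. a \<in> F \<Longrightarrow> p a \<in> polynomial_functions scale"
    and nz: "\<And>a. a \<in> F \<Longrightarrow> \<exists>g\<in>GL scale. p a g \<noteq> 0"
  shows "\<exists>g\<in>GL scale. (\<Prod>a\<in>F. p a g) \<noteq> 0"
  using fin F nz
proof (induction F rule: finite_induct)
  case empty
  have "id \<in> GL scale" by (simp add: GL_def linear_id)
  then show ?case by auto
next
  case (insert a F)
  have "\<exists>h\<in>GL scale. (\<Prod>a\<in>F. p a h) \<noteq> 0" by (rule insert.IH) (use insert.prems in blast)+
  moreover have "\<exists>g\<in>GL scale. p a g \<noteq> 0" using insert.prems by blast
  ultimately obtain g h where "g \<in> GL scale" "p a g \<noteq> 0" "h \<in> GL scale" "(\<Prod>a\<in>F. p a h) \<noteq> 0"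
    by blast
  then obtain l where "l \<in> GL scale" "p a l \<noteq> 0" "(\<Prod>a\<in>F. p a l) \<noteq> 0"
    using GL_irreducible[OF inf, of "p a" g "\<lambda>g. \<Prod>a\<in>F. p a g" h] insert.prems
      polynomial_functions_prod[of F p scale] by auto
  then show ?case using insert.hyps by auto
qed

text \<open>
  Every nonempty open set contains a nonempty principal open set, which by irreducibility meets the
  given one.
\<close>

lemma principal_open_dense:
  assumes inf: "infinite (UNIV :: 'a set)"
    and p: "p \<in> polynomial_functions scale" and nz: "\<exists>g\<in>GL scale. p g \<noteq> 0"
  shows "openin (zariski_GL scale) {g \<in> GL scale. p g \<noteq> 0}"
    and "zariski_GL scale closure_of {g \<in> GL scale. p g \<noteq> 0} = topspace (zariski_GL scale)"
proof -
  let ?B = "{{g \<in> GL scale. p g \<noteq> 0} | p. p \<in> polynomial_functions scale}"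
  show "openin (zariski_GL scale) {g \<in> GL scale. p g \<noteq> 0}"
    unfolding zariski_GL_def by (rule topology_generated_by_Basis) (use p in blast)
  have nbhd: "\<exists>q\<in>polynomial_functions scale. q g \<noteq> 0 \<and> {h \<in> GL scale. q h \<noteq> 0} \<subseteq> T"
    if "generate_topology_on ?B T" "g \<in> T" for T g
    using that
  proof (induction)
    case (Int S T)
    then obtain q r where "q \<in> polynomial_functions scale" "q g \<noteq> 0" "{h \<in> GL scale. q h \<noteq> 0} \<subseteq> S"
      "r \<in> polynomial_functions scale" "r g \<noteq> 0" "{h \<in> GL scale. r h \<noteq> 0} \<subseteq> T" by auto
    then show ?case
      by (intro bexI[of _ "\<lambda>g. q g * r g"]) (auto intro: polynomial_functions.mult)
  next
    case (UN K)
    then show ?case by (meson UnionE Sup_upper order_trans)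
  next
    case (Basis S)
    then show ?case by auto
  qed simp
  show "zariski_GL scale closure_of {g \<in> GL scale. p g \<noteq> 0} = topspace (zariski_GL scale)"
  proof (rule antisym[OF closure_of_subset_topspace], rule subsetI)
    fix g assume g: "g \<in> topspace (zariski_GL scale)"
    have "\<exists>l\<in>{g \<in> GL scale. p g \<noteq> 0}. l \<in> T" if T: "g \<in> T" "openin (zariski_GL scale) T" for T
    proof -
      have "generate_topology_on ?B T"
        using T(2) unfolding zariski_GL_def openin_topology_generated_by_iff .
      from nbhd[OF this T(1)] obtain q where q: "q \<in> polynomial_functions scale" "q g \<noteq> 0"
        "{h \<in> GL scale. q h \<noteq> 0} \<subseteq> T" by blast
      then show ?thesis
        using GL_irreducible[OF inf p] nz g q(1,2) unfolding topspace_zariski_GL by blast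
    qed
    with g show "g \<in> zariski_GL scale closure_of {g \<in> GL scale. p g \<noteq> 0}"
      by (auto simp: in_closure_of)
  qed
qed

end

section \<open>The polynomial ring as a vector space\<close>

lemma poly_mapping_sum_single: "f = (\<Sum>m\<in>Poly_Mapping.keys f. Poly_Mapping.single m (Poly_Mapping.lookup f m))"
  by (rule poly_mapping_eqI)
     (simp add: lookup_sum lookup_single when_def in_keys_iff)

definition scale_poly :: "'k::field \<Rightarrow> 'k mpoly \<Rightarrow> 'k mpoly" where
  "scale_poly c f = Poly_Mapping.single 0 c * f"

lemma lookup_scale_poly [simp]: "Poly_Mapping.lookup (scale_poly c f) m = c * Poly_Mapping.lookup f m"
  unfolding scale_poly_def mult_map_scale_conv_mult[symmetric]
  by (simp add: Poly_Mapping.map.rep_eq when_def)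

lemma scale_poly_single [simp]: "scale_poly c (Poly_Mapping.single m d) = Poly_Mapping.single m (c * d)"
  by (simp add: scale_poly_def mult_single)

global_interpretation poly_vs: vector_space scale_poly
  by unfold_locales (simp_all add: scale_poly_def algebra_simps single_add mult_single flip: mult.assoc)

lemma keys_scale_poly: "Poly_Mapping.keys (scale_poly c f) \<subseteq> Poly_Mapping.keys f"
  by (auto simp: in_keys_iff)

lemma scale_poly_mult_left: "scale_poly c f * g = scale_poly c (f * g)"
  by (simp add: scale_poly_def mult.assoc)

lemma scale_poly_mult_right: "f * scale_poly c g = scale_poly c (f * g)"
  by (simp add: scale_poly_def algebra_simps)

lemma poly_expansion_superset:
  fixes f :: "'k::field mpoly"
  assumes "finite A" "Poly_Mapping.keys f \<subseteq> A"
  shows "f = (\<Sum>m\<in>A. scale_poly (Poly_Mapping.lookup f m) (Poly_Mapping.single m 1))"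
  using assms
  by (intro poly_mapping_eqI)
     (auto simp: lookup_sum lookup_single when_def in_keys_iff subset_iff)

section \<open>Substitution homomorphisms\<close>

definition monomial_subst :: "(nat \<Rightarrow> ('k::field) mpoly) \<Rightarrow> monomial \<Rightarrow> 'k mpoly" where
  "monomial_subst \<sigma> m = (\<Prod>i\<in>Poly_Mapping.keys m. \<sigma> i ^ Poly_Mapping.lookup m i)"

lemma monomial_subst_add: "monomial_subst \<sigma> (a + b) = monomial_subst \<sigma> a * monomial_subst \<sigma> b"
proof -
  let ?K = "Poly_Mapping.keys a \<union> Poly_Mapping.keys b"
  have ext: "monomial_subst \<sigma> m = (\<Prod>i\<in>?K. \<sigma> i ^ Poly_Mapping.lookup m i)"
    if "Poly_Mapping.keys m \<subseteq> ?K" for m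
    unfolding monomial_subst_def using that
    by (intro prod.mono_neutral_left) (auto simp: in_keys_iff)
  have "monomial_subst \<sigma> (a + b) = (\<Prod>i\<in>?K. \<sigma> i ^ Poly_Mapping.lookup (a + b) i)"
    by (rule ext) (rule Poly_Mapping.keys_add)
  also have "\<dots> = (\<Prod>i\<in>?K. \<sigma> i ^ Poly_Mapping.lookup a i) * (\<Prod>i\<in>?K. \<sigma> i ^ Poly_Mapping.lookup b i)"
    by (simp add: lookup_add power_add prod.distrib)
  also have "\<dots> = monomial_subst \<sigma> a * monomial_subst \<sigma> b"
    by (subst (1 2) ext) auto
  finally show ?thesis .
qed

lemma monomial_subst_zero [simp]: "monomial_subst \<sigma> 0 = 1"
  by (simp add: monomial_subst_def)

lemma monomial_subst_var [simp]: "monomial_subst \<sigma> (Poly_Mapping.single i 1) = \<sigma> i"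
  by (simp add: monomial_subst_def)

lemma poly_subst_superset:
  assumes "finite K" "Poly_Mapping.keys f \<subseteq> K"
  shows "poly_subst \<sigma> f = (\<Sum>m\<in>K. scale_poly (Poly_Mapping.lookup f m) (monomial_subst \<sigma> m))"
  unfolding poly_subst_def monomial_subst_def[symmetric] scale_poly_def[symmetric]
  using assms by (intro sum.mono_neutral_left) (auto simp: in_keys_iff)

lemma poly_subst_add: "poly_subst \<sigma> (f + g) = poly_subst \<sigma> f + poly_subst \<sigma> g"
  using Poly_Mapping.keys_add[of f g]
  by (subst (1 2 3) poly_subst_superset[of "Poly_Mapping.keys f \<union> Poly_Mapping.keys g"])
     (auto simp: lookup_add poly_vs.scale_left_distrib sum.distrib)

lemma poly_subst_single: "poly_subst \<sigma> (Poly_Mapping.single m c) = scale_poly c (monomial_subst \<sigma> m)"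
  by (subst poly_subst_superset[of "{m}"]) auto

lemma poly_subst_zero [simp]: "poly_subst \<sigma> 0 = 0"
  by (simp add: poly_subst_def)

lemma poly_subst_one [simp]: "poly_subst \<sigma> 1 = 1"
  using poly_subst_single[of \<sigma> 0 1] by simp

lemma poly_subst_sum: "poly_subst \<sigma> (\<Sum>a\<in>A. f a) = (\<Sum>a\<in>A. poly_subst \<sigma> (f a))"
  by (induction A rule: infinite_finite_induct) (simp_all add: poly_subst_add)

lemma poly_subst_mult: "poly_subst \<sigma> (f * g) = poly_subst \<sigma> f * poly_subst \<sigma> g"
proof -
  have single: "poly_subst \<sigma> (Poly_Mapping.single a c * Poly_Mapping.single b d) =
      poly_subst \<sigma> (Poly_Mapping.single a c) * poly_subst \<sigma> (Poly_Mapping.single b d)" for a b c d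
    by (simp add: mult_single poly_subst_single monomial_subst_add scale_poly_mult_left
        scale_poly_mult_right mult.commute)
  show ?thesis
    by (subst (1 2) poly_mapping_sum_single[of f], subst (1 2) poly_mapping_sum_single[of g])
       (simp only: sum_product poly_subst_sum single)
qed

lemma poly_subst_power: "poly_subst \<sigma> (f ^ k) = poly_subst \<sigma> f ^ k"
  by (induction k) (simp_all add: poly_subst_mult)

lemma poly_subst_prod: "poly_subst \<sigma> (\<Prod>a\<in>A. f a) = (\<Prod>a\<in>A. poly_subst \<sigma> (f a))"
  by (induction A rule: infinite_finite_induct) (simp_all add: poly_subst_mult)

lemma poly_subst_scale: "poly_subst \<sigma> (scale_poly c f) = scale_poly c (poly_subst \<sigma> f)"
  by (simp add: scale_poly_def poly_subst_mult poly_subst_single)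

lemma vector_space_linearI:
  assumes "vector_space s1" "vector_space s2"
    and "\<And>u v. f (u + v) = f u + f v" "\<And>c v. f (s1 c v) = s2 c (f v)"
  shows "Vector_Spaces.linear s1 s2 f"
  using assms
  by (simp add: Vector_Spaces.linear_def module_hom_def module_hom_axioms_def module_iff_vector_space)

lemma poly_subst_linear: "Vector_Spaces.linear scale_poly scale_poly (poly_subst \<sigma>)"
  by (intro vector_space_linearI poly_vs.vector_space_axioms poly_subst_add poly_subst_scale)

lemma poly_subst_subst: "poly_subst \<sigma> (poly_subst \<tau> f) = poly_subst (\<lambda>j. poly_subst \<sigma> (\<tau> j)) f"
  unfolding poly_subst_superset[OF finite_keys order_refl, of _ f]
  by (simp add: poly_subst_sum poly_subst_scale monomial_subst_def poly_subst_prod poly_subst_power)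

lemma poly_subst_cong:
  assumes "f \<in> polys n" "\<And>j. j < n \<Longrightarrow> \<sigma> j = \<tau> j"
  shows "poly_subst \<sigma> f = poly_subst \<tau> f"
  unfolding poly_subst_def using assms
  by (intro sum.cong refl arg_cong2[where f = times] prod.cong arg_cong2[where f = power])
     (auto simp: polys_def)

lemma poly_subst_vars:
  fixes f :: "'k::field mpoly"
  shows "poly_subst (\<lambda>j. Poly_Mapping.single (Poly_Mapping.single j 1) 1) f = f"
proof -
  have pow: "Poly_Mapping.single a (1::'k::field) ^ k = Poly_Mapping.single (of_nat k * a) 1"
    for a :: monomial and k
    by (induction k) (simp_all add: mult_single algebra_simps)
  have prod: "(\<Prod>i\<in>K. Poly_Mapping.single (a i) (1::'k::field)) = Poly_Mapping.single (\<Sum>i\<in>K. a i) 1"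
    for a :: "nat \<Rightarrow> monomial" and K
    by (induction K rule: infinite_finite_induct) (simp_all add: mult_single)
  have "monomial_subst (\<lambda>j. Poly_Mapping.single (Poly_Mapping.single j 1) (1::'k::field)) m =
      Poly_Mapping.single m 1" for m
  proof -
    have "of_nat k * Poly_Mapping.single i 1 = (Poly_Mapping.single i k :: monomial)" for k i
      by (induction k) (simp_all add: algebra_simps flip: single_add)
    then show ?thesis
      unfolding monomial_subst_def pow prod by (simp flip: poly_mapping_sum_single)
  qed
  then show ?thesis
    unfolding poly_subst_superset[OF finite_keys order_refl]
    by (simp del: One_nat_def flip: poly_mapping_sum_single)
qed

section \<open>Homogeneous polynomials\<close>

lemma polys_zero [simp]: "0 \<in> polys n" and polys_one [simp]: "1 \<in> polys n"
  by (simp_all add: polys_def)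

lemma polys_single: "Poly_Mapping.keys m \<subseteq> {..<n} \<Longrightarrow> Poly_Mapping.single m c \<in> polys n"
  by (simp add: polys_def)

lemma polys_sum: "(\<And>a. a \<in> A \<Longrightarrow> f a \<in> polys n) \<Longrightarrow> (\<Sum>a\<in>A. f a) \<in> polys n"
  by (induction A rule: infinite_finite_induct) (simp_all add: polys_plus)

lemma polys_power: "f \<in> polys n \<Longrightarrow> f ^ k \<in> polys n"
  by (induction k) (simp_all add: polys_times)

lemma polys_prod: "(\<And>a. a \<in> A \<Longrightarrow> f a \<in> polys n) \<Longrightarrow> (\<Prod>a\<in>A. f a) \<in> polys n"
  by (induction A rule: infinite_finite_induct) (simp_all add: polys_times)

lemma polys_scale: "f \<in> polys n \<Longrightarrow> scale_poly c f \<in> polys n"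
  by (simp add: scale_poly_def polys_times polys_single)

lemma polys_subst: "(\<And>j. \<sigma> j \<in> polys n) \<Longrightarrow> poly_subst \<sigma> f \<in> polys n"
  unfolding poly_subst_superset[OF finite_keys order_refl] monomial_subst_def
  by (intro polys_sum polys_scale polys_prod polys_power)

definition homogeneous :: "nat \<Rightarrow> ('k::field) mpoly \<Rightarrow> bool" where
  "homogeneous d f \<longleftrightarrow> (\<forall>m\<in>Poly_Mapping.keys f. total_degree m = d)"

lemma homogeneous_add: "homogeneous d f \<Longrightarrow> homogeneous d g \<Longrightarrow> homogeneous d (f + g)"
  using Poly_Mapping.keys_add[of f g] by (auto simp: homogeneous_def)

lemma homogeneous_zero [simp]: "homogeneous d 0" by (simp add: homogeneous_def)

lemma homogeneous_sum: "(\<And>a. a \<in> A \<Longrightarrow> homogeneous d (f a)) \<Longrightarrow> homogeneous d (\<Sum>a\<in>A. f a)"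
  by (induction A rule: infinite_finite_induct) (simp_all add: homogeneous_add)

lemma homogeneous_scale: "homogeneous d f \<Longrightarrow> homogeneous d (scale_poly c f)"
  using keys_scale_poly[of c f] by (auto simp: homogeneous_def)

lemma homogeneous_single: "homogeneous (total_degree m) (Poly_Mapping.single m c)"
  by (simp add: homogeneous_def)

lemma homogeneous_mult: "homogeneous d f \<Longrightarrow> homogeneous e g \<Longrightarrow> homogeneous (d + e) (f * g)"
  using keys_mult[of f g] by (fastforce simp: homogeneous_def total_degree_add)

lemma homogeneous_one: "homogeneous 0 1"
  by (simp add: homogeneous_def total_degree_def)

lemma homogeneous_power: "homogeneous d f \<Longrightarrow> homogeneous (k * d) (f ^ k)"
  by (induction k) (simp_all add: homogeneous_mult homogeneous_one)

lemma homogeneous_prod: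
  "(\<And>a. a \<in> A \<Longrightarrow> homogeneous (d a) (f a)) \<Longrightarrow> homogeneous (\<Sum>a\<in>A. d a) (\<Prod>a\<in>A. f a)"
  by (induction A rule: infinite_finite_induct) (simp_all add: homogeneous_mult homogeneous_one)

lemma homogeneous_monomial_subst:
  assumes "\<And>j. homogeneous 1 (\<sigma> j)"
  shows "homogeneous (total_degree m) (monomial_subst \<sigma> m)"
  unfolding monomial_subst_def total_degree_def
  by (rule homogeneous_prod) (use homogeneous_power[OF assms] in simp)

lemma lookup_homogeneous_component:
  "Poly_Mapping.lookup (homogeneous_component d f) m = (if total_degree m = d then Poly_Mapping.lookup f m else 0)"
  unfolding homogeneous_component_def
  by (auto simp: lookup_sum lookup_single when_def in_keys_iff)

lemma homogeneous_component_homogeneous: "homogeneous d (homogeneous_component d f)"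
  by (auto simp: homogeneous_def in_keys_iff lookup_homogeneous_component split: if_splits)

lemma homogeneous_component_add:
  "homogeneous_component d (f + g) = homogeneous_component d f + homogeneous_component d g"
  by (rule poly_mapping_eqI) (simp add: lookup_homogeneous_component lookup_add)

lemma homogeneous_component_zero [simp]: "homogeneous_component d 0 = 0"
  by (rule poly_mapping_eqI) (simp add: lookup_homogeneous_component)

lemma homogeneous_component_sum:
  "homogeneous_component d (\<Sum>a\<in>A. f a) = (\<Sum>a\<in>A. homogeneous_component d (f a))"
  by (induction A rule: infinite_finite_induct) (simp_all add: homogeneous_component_add)

lemma homogeneous_component_of_homogeneous:
  "homogeneous e f \<Longrightarrow> homogeneous_component d f = (if d = e then f else 0)"
  by (rule poly_mapping_eqI)
     (auto simp: lookup_homogeneous_component homogeneous_def in_keys_iff)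

lemma homogeneous_component_subst:
  assumes "\<And>j. homogeneous 1 (\<sigma> j)"
  shows "homogeneous_component d (poly_subst \<sigma> f) = poly_subst \<sigma> (homogeneous_component d f)"
proof -
  have single: "homogeneous_component d (poly_subst \<sigma> (Poly_Mapping.single m c)) =
      poly_subst \<sigma> (homogeneous_component d (Poly_Mapping.single m c))" for m c
  proof -
    have "homogeneous (total_degree m) (poly_subst \<sigma> (Poly_Mapping.single m c))"
      unfolding poly_subst_single by (intro homogeneous_scale homogeneous_monomial_subst assms)
    then show ?thesis
      by (simp add: homogeneous_component_of_homogeneous homogeneous_component_of_homogeneous[OF homogeneous_single])
  qed
  show ?thesis
    by (subst (1 2) poly_mapping_sum_single[of f])
       (simp only: poly_subst_sum homogeneous_component_sum single)
qed


section \<open>Initial monomials and the matroid of free sets\<close>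

lemma weight_add: "weight n w (a + b) = weight n w a + weight n w b"
  by (simp add: weight_def lookup_add distrib_left sum.distrib)

lemma weight_less_irrefl: "\<not> weight_less n w m m"
  by (simp add: weight_less_def)

lemma weight_less_trans: "weight_less n w a b \<Longrightarrow> weight_less n w b c \<Longrightarrow> weight_less n w a c"
  by (auto simp: weight_less_def)

lemma weight_less_add_left: "weight_less n w a b \<Longrightarrow> weight_less n w (c + a) (c + b)"
  by (auto simp: weight_less_def weight_add monomial_less_iff lookup_add)

lemma initial_monomial_spec:
  assumes "f \<noteq> 0"
  shows "initial_monomial n w f \<in> Poly_Mapping.keys f"
    and "m \<in> Poly_Mapping.keys f \<Longrightarrow> m \<noteq> initial_monomial n w f \<Longrightarrow> weight_less n w m (initial_monomial n w f)"
  using theI'[OF ex1_initial_monomial[OF assms, of n w]] unfolding initial_monomial_def by blast+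

lemma initial_monomial_eqI:
  assumes "m \<in> Poly_Mapping.keys f" "\<And>m'. m' \<in> Poly_Mapping.keys f \<Longrightarrow> m' \<noteq> m \<Longrightarrow> weight_less n w m' m"
  shows "initial_monomial n w f = m"
proof -
  have f: "f \<noteq> 0" using assms(1) by auto
  show ?thesis
    using initial_monomial_spec(1)[OF f, of n w] initial_monomial_spec(2)[OF f assms(1), of n w]
      assms(2) weight_less_trans weight_less_irrefl by blast
qed

text \<open>
  Multiplication by a monomial shifts the coefficients, hence the support, hence the initial monomial.
\<close>

lemma lookup_single_mult:
  fixes b :: monomial
  shows "Poly_Mapping.lookup (Poly_Mapping.single b (1::'k::field) * f) (b + m) = Poly_Mapping.lookup f m"
proof -
  have "Poly_Mapping.single b 1 * f =
      (\<Sum>m\<in>Poly_Mapping.keys f. Poly_Mapping.single (b + m) (Poly_Mapping.lookup f m))"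
    by (subst poly_mapping_sum_single[of f]) (simp add: sum_distrib_left mult_single)
  then show ?thesis
    by (simp add: lookup_sum lookup_single when_def in_keys_iff)
qed

lemma keys_single_mult:
  fixes b :: monomial
  shows "Poly_Mapping.keys (Poly_Mapping.single b (1::'k::field) * f) = (+) b ` Poly_Mapping.keys f"
proof
  show "Poly_Mapping.keys (Poly_Mapping.single b 1 * f) \<subseteq> (+) b ` Poly_Mapping.keys f"
    using keys_mult[of "Poly_Mapping.single b 1" f] by auto
  show "(+) b ` Poly_Mapping.keys f \<subseteq> Poly_Mapping.keys (Poly_Mapping.single b 1 * f)"
    by (auto simp: in_keys_iff lookup_single_mult)
qed

lemma initial_monomial_single_mult:
  assumes "f \<noteq> 0"
  shows "initial_monomial n w (Poly_Mapping.single b 1 * f) = b + initial_monomial n w f"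
  by (rule initial_monomial_eqI)
     (use initial_monomial_spec(1)[OF assms, of n w] initial_monomial_spec(2)[OF assms, of _ n w]
      in \<open>auto simp: keys_single_mult intro!: weight_less_add_left\<close>)

definition initial_monomials :: "nat \<Rightarrow> (nat \<Rightarrow> real) \<Rightarrow> ('k::field) mpoly set \<Rightarrow> monomial set" where
  "initial_monomials n w J = {initial_monomial n w f | f. f \<in> J \<and> f \<noteq> 0}"

text \<open>
  Equivalently, the monomials in \<open>A\<close> are linearly independent modulo the subspace \<open>J\<close>.
\<close>

definition free_monomials :: "('k::field) mpoly set \<Rightarrow> monomial set \<Rightarrow> bool" where
  "free_monomials J A \<longleftrightarrow> (\<forall>f\<in>J. Poly_Mapping.keys f \<subseteq> A \<longrightarrow> f = 0)"

lemma initial_ideal_eq_genideal: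
  "initial_ideal n w J = genideal (poly_ring n) ((\<lambda>m. Poly_Mapping.single m 1) ` initial_monomials n w J)"
  unfolding initial_ideal_def initial_monomials_def
  by (rule arg_cong[where f = "genideal (poly_ring n)"]) blast

lemma groebner_fan_cong:
  fixes J J' :: "('k::field) mpoly set"
  assumes "\<And>w. initial_monomials n w J = initial_monomials n w J'"
  shows "groebner_fan n J = groebner_fan n J'"
  by (simp add: groebner_fan_def weight_class_def initial_ideal_eq_genideal assms)

text \<open>
  Graded ideals of the polynomial ring in \<open>n\<close> variables, in terms of the operations of the ambient
  type.
\<close>

locale graded_polynomial_ideal =
  fixes n :: nat and J :: "('k::field) mpoly set"
  assumes subset_polys: "J \<subseteq> polys n"
    and zero_mem: "0 \<in> J"
    and add_mem: "f \<in> J \<Longrightarrow> g \<in> J \<Longrightarrow> f + g \<in> J"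
    and mult_mem: "f \<in> J \<Longrightarrow> h \<in> polys n \<Longrightarrow> h * f \<in> J"
    and component_mem: "f \<in> J \<Longrightarrow> homogeneous_component d f \<in> J"
begin

lemma scale_mem: "f \<in> J \<Longrightarrow> scale_poly c f \<in> J"
  unfolding scale_poly_def by (intro mult_mem polys_single) simp_all

lemma diff_mem: "f \<in> J \<Longrightarrow> g \<in> J \<Longrightarrow> f - g \<in> J"
  using add_mem[of f "scale_poly (-1) g"] scale_mem[of g "-1"] by simp

lemma subspace: "poly_vs.subspace J"
  by (intro poly_vs.subspaceI zero_mem add_mem scale_mem)

lemma keys_in_mons:
  "f \<in> J \<Longrightarrow> homogeneous d f \<Longrightarrow> Poly_Mapping.keys f \<subseteq> mons n d"
  using subset_polys by (auto simp: polys_def homogeneous_def mons_def)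

lemma initial_monomials_upset: "monomial_upset n (initial_monomials n w J)"
  unfolding monomial_upset_def
proof (intro conjI ballI allI impI subsetI)
  fix a assume "a \<in> initial_monomials n w J"
  then obtain f where f: "f \<in> J" "f \<noteq> 0" "a = initial_monomial n w f"
    by (auto simp: initial_monomials_def)
  then show "a \<in> (\<Union>d. mons n d)"
    using initial_monomial_spec(1)[of f n w] subset_polys by (auto simp: polys_def mons_def)
  fix b :: monomial assume b: "Poly_Mapping.keys b \<subseteq> {..<n}"
  have "Poly_Mapping.single b 1 * f \<noteq> 0"
    using keys_single_mult[of b f] f(2) by (metis image_is_empty keys_eq_empty)
  moreover have "Poly_Mapping.single b 1 * f \<in> J"
    by (rule mult_mem[OF f(1) polys_single[OF b]])
  moreover have "a + b = initial_monomial n w (Poly_Mapping.single b 1 * f)"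
    unfolding initial_monomial_single_mult[OF f(2)] f(3) by (rule add.commute)
  ultimately show "a + b \<in> initial_monomials n w J"
    unfolding initial_monomials_def by blast
qed

text \<open>
  Passing to the homogeneous component that contains the initial monomial keeps it initial.
\<close>

lemma homogeneous_initial_witness:
  assumes "m \<in> initial_monomials n w J" "total_degree m = d"
  obtains f where "f \<in> J" "homogeneous d f" "m \<in> Poly_Mapping.keys f"
    "\<And>m'. m' \<in> Poly_Mapping.keys f \<Longrightarrow> m' \<noteq> m \<Longrightarrow> weight_less n w m' m"
proof -
  obtain f where f: "f \<in> J" "f \<noteq> 0" "m = initial_monomial n w f"
    using assms(1) by (auto simp: initial_monomials_def)
  have keys: "Poly_Mapping.keys (homogeneous_component d f) = {k \<in> Poly_Mapping.keys f. total_degree k = d}"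
    by (auto simp: in_keys_iff lookup_homogeneous_component split: if_splits)
  show ?thesis
    by (rule that[of "homogeneous_component d f"])
       (use f assms(2) initial_monomial_spec(1)[OF f(2), of n w] initial_monomial_spec(2)[OF f(2), of _ n w] component_mem
          homogeneous_component_homogeneous in \<open>auto simp: keys\<close>)
qed

text \<open>
  The division algorithm in a fixed degree. In each step the largest monomial of \<open>f\<close> either moves to
  the remainder or is cancelled by an element of \<open>J\<close> with that initial monomial; all monomials that
  arise are smaller. The set \<open>L\<close> records that the remainder never involves monomials above
  those of \<open>f\<close>. Inside one degree there are finitely many monomials, so the process stops although
  weights may be negative.
\<close>

lemma division:
  assumes "L \<subseteq> mons n d" "\<And>a b. a \<in> L \<Longrightarrow> b \<in> mons n d \<Longrightarrow> weight_less n w b a \<Longrightarrow> b \<in> L"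
    and "Poly_Mapping.keys f \<subseteq> L"
  shows "\<exists>r. Poly_Mapping.keys r \<subseteq> L - initial_monomials n w J \<and> f - r \<in> J"
proof -
  have "finite L" using assms(1) finite_mons by (rule finite_subset)
  then show ?thesis using assms
  proof (induction L arbitrary: f rule: finite_psubset_induct)
    case (psubset L)
    show ?case
    proof (cases "f = 0")
      case True
      then show ?thesis by (intro exI[of _ 0]) (simp add: zero_mem)
    next
      case False
      define m where "m = initial_monomial n w f"
      have m: "m \<in> Poly_Mapping.keys f"
        "\<And>m'. m' \<in> Poly_Mapping.keys f \<Longrightarrow> m' \<noteq> m \<Longrightarrow> weight_less n w m' m"
        unfolding m_def using initial_monomial_spec[OF False] by blast+
      then have mL: "m \<in> L" using psubset.prems(3) by blast
      then have md: "m \<in> mons n d" using psubset.prems(1) by blast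
      define K where "K = {b \<in> L. weight_less n w b m}"
      have K: "K \<subset> L" using mL weight_less_irrefl by (auto simp: K_def)
      have IH: "\<exists>r. Poly_Mapping.keys r \<subseteq> K - initial_monomials n w J \<and> g - r \<in> J"
        if "Poly_Mapping.keys g \<subseteq> K" for g
      proof (rule psubset.IH[OF K])
        show "K \<subseteq> mons n d" using psubset.prems(1) by (auto simp: K_def)
        show "b \<in> K" if "a \<in> K" "b \<in> mons n d" "weight_less n w b a" for a b
          using that psubset.prems(2)[of a b] weight_less_trans by (auto simp: K_def)
      qed (rule that)
      have below: "Poly_Mapping.keys g \<subseteq> K"
        if "Poly_Mapping.lookup g m = 0"
          "\<And>k. k \<in> Poly_Mapping.keys g \<Longrightarrow> k \<in> L \<and> (k = m \<or> weight_less n w k m)" for g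
        using that by (auto simp: K_def in_keys_iff)
      have f_below: "k \<in> L \<and> (k = m \<or> weight_less n w k m)" if "k \<in> Poly_Mapping.keys f" for k
        using that m(2) psubset.prems(3) by blast
      show ?thesis
      proof (cases "m \<in> initial_monomials n w J")
        case False
        define g where "g = f - Poly_Mapping.single m (Poly_Mapping.lookup f m)"
        have "Poly_Mapping.keys g \<subseteq> K"
        proof (rule below)
          show "Poly_Mapping.lookup g m = 0" by (simp add: g_def lookup_minus)
          show "k \<in> L \<and> (k = m \<or> weight_less n w k m)" if "k \<in> Poly_Mapping.keys g" for k
            using that f_below[of k] mL
            by (auto simp: g_def in_keys_iff lookup_minus lookup_single when_def split: if_splits)
        qed
        then obtain r where r: "Poly_Mapping.keys r \<subseteq> K - initial_monomials n w J" "g - r \<in> J"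
          using IH by blast
        define s where "s = r + Poly_Mapping.single m (Poly_Mapping.lookup f m)"
        have "Poly_Mapping.keys s \<subseteq> insert m (Poly_Mapping.keys r)"
          unfolding s_def using Poly_Mapping.keys_add[of r "Poly_Mapping.single m (Poly_Mapping.lookup f m)"]
          by (auto split: if_splits)
        then have "Poly_Mapping.keys s \<subseteq> L - initial_monomials n w J"
          using r(1) False mL K by blast
        moreover have "f - s \<in> J" using r(2) by (simp add: g_def s_def algebra_simps)
        ultimately show ?thesis by blast
      next
        case True
        obtain h where h: "h \<in> J" "homogeneous d h" "m \<in> Poly_Mapping.keys h"
          "\<And>m'. m' \<in> Poly_Mapping.keys h \<Longrightarrow> m' \<noteq> m \<Longrightarrow> weight_less n w m' m"
          using homogeneous_initial_witness[OF True] md by (auto simp: mons_def)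
        define c where "c = Poly_Mapping.lookup f m / Poly_Mapping.lookup h m"
        define g where "g = f - scale_poly c h"
        have "Poly_Mapping.keys g \<subseteq> K"
        proof (rule below)
          show "Poly_Mapping.lookup g m = 0" using h(3) by (simp add: g_def c_def lookup_minus in_keys_iff)
          fix k assume "k \<in> Poly_Mapping.keys g"
          then have "k \<in> Poly_Mapping.keys f \<or> k \<in> Poly_Mapping.keys h"
            by (auto simp: g_def in_keys_iff lookup_minus)
          then consider "k \<in> Poly_Mapping.keys f" | "k \<in> Poly_Mapping.keys h" by blast
          then show "k \<in> L \<and> (k = m \<or> weight_less n w k m)"
          proof cases
            case 2
            then show ?thesis
              using h(4)[of k] mL psubset.prems(2)[OF mL, of k] keys_in_mons[OF h(1,2)] by blast
          qed (rule f_below)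
        qed
        then obtain r where r: "Poly_Mapping.keys r \<subseteq> K - initial_monomials n w J" "g - r \<in> J"
          using IH by blast
        have "(g - r) + scale_poly c h \<in> J" by (intro add_mem r(2) scale_mem h(1))
        then have "f - r \<in> J" by (simp add: g_def algebra_simps)
        then show ?thesis using r(1) K by blast
      qed
    qed
  qed
qed

lemma free_disjoint_initial_monomials:
  assumes "A \<inter> initial_monomials n w J = {}"
  shows "free_monomials J A"
  unfolding free_monomials_def
proof (intro ballI impI, rule ccontr)
  fix f assume f: "f \<in> J" "Poly_Mapping.keys f \<subseteq> A" "f \<noteq> 0"
  then have "initial_monomial n w f \<in> A \<inter> initial_monomials n w J"
    using initial_monomial_spec(1)[OF f(3)] by (auto simp: initial_monomials_def)
  then show False using assms by blast
qed

text \<open>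
  The greedy algorithm: running through the monomials of degree \<open>d\<close> in increasing order, a monomial
  is kept exactly if it is independent, modulo \<open>J\<close>, of the monomials kept before. If \<open>m\<close> is initial,
  dividing \<open>m\<close> leaves a remainder in smaller standard monomials, and \<open>m\<close> minus this remainder is
  a nonzero element of \<open>J\<close>.
\<close>

lemma standard_iff_free:
  assumes m: "m \<in> mons n d"
  shows "m \<notin> initial_monomials n w J \<longleftrightarrow>
    free_monomials J (insert m {b \<in> mons n d - initial_monomials n w J. weight_less n w b m})"
    (is "_ \<longleftrightarrow> free_monomials J (insert m ?S)")
proof
  assume "m \<notin> initial_monomials n w J"
  then show "free_monomials J (insert m ?S)"
    by (intro free_disjoint_initial_monomials) auto
next
  assume free: "free_monomials J (insert m ?S)"
  show "m \<notin> initial_monomials n w J"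
  proof
    assume mI: "m \<in> initial_monomials n w J"
    define L where "L = {b \<in> mons n d. b = m \<or> weight_less n w b m}"
    obtain r where r: "Poly_Mapping.keys r \<subseteq> L - initial_monomials n w J" "Poly_Mapping.single m 1 - r \<in> J"
      using division[of L d w "Poly_Mapping.single m 1"] m weight_less_trans[of n w] by (auto simp: L_def)
    have "Poly_Mapping.keys r \<subseteq> ?S" using r(1) mI by (auto simp: L_def)
    moreover from this have rm: "Poly_Mapping.lookup r m = 0" using mI by (auto simp: in_keys_iff)
    ultimately have "Poly_Mapping.keys (Poly_Mapping.single m 1 - r) \<subseteq> insert m ?S"
      by (auto simp: in_keys_iff lookup_minus lookup_single when_def split: if_splits)
    then have "Poly_Mapping.single m 1 - r = 0" using free r(2) unfolding free_monomials_def by blast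
    then have "Poly_Mapping.lookup (Poly_Mapping.single m 1 - r) m = 0" by simp
    then show False using rm by (simp add: lookup_minus)
  qed
qed

text \<open>
  For each initial monomial \<open>t\<close> of degree \<open>d\<close>, division gives an element \<open>e t\<close> of \<open>J\<close> that consists of
  \<open>t\<close> and standard monomials. These elements form a basis of the degree \<open>d\<close> part: the coefficient of
  \<open>t\<close> in a combination is the coefficient of \<open>e t\<close>, and after subtracting a suitable
  combination only standard monomials remain, and no nonzero element of \<open>J\<close> consists of these.
\<close>

lemma card_initial_monomials:
  "card (initial_monomials n w J \<inter> mons n d) = poly_vs.dim {f \<in> J. homogeneous d f}"
proof -
  define M where "M = initial_monomials n w J \<inter> mons n d"
  have finM: "finite M" by (simp add: M_def finite_mons)
  have "\<exists>r. Poly_Mapping.keys r \<subseteq> mons n d - initial_monomials n w J \<and> Poly_Mapping.single t 1 - r \<in> J"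
    if "t \<in> M" for t
    by (rule division) (use that in \<open>auto simp: M_def\<close>)
  then obtain r where r: "\<And>t. t \<in> M \<Longrightarrow> Poly_Mapping.keys (r t) \<subseteq> mons n d - initial_monomials n w J"
    "\<And>t. t \<in> M \<Longrightarrow> Poly_Mapping.single t 1 - r t \<in> J" by metis
  define e where "e t = Poly_Mapping.single t 1 - r t" for t
  have eJ: "e t \<in> J" if "t \<in> M" for t using r(2)[OF that] by (simp add: e_def)
  have e_lookup: "Poly_Mapping.lookup (e t) s = (if s = t then 1 else 0)" if "t \<in> M" "s \<in> M" for s t
  proof -
    have "s \<notin> Poly_Mapping.keys (r t)" using r(1)[OF that(1)] that(2) by (auto simp: M_def)
    then show ?thesis by (simp add: e_def lookup_minus lookup_single when_def in_keys_iff)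
  qed
  have e_hom: "homogeneous d (e t)" if "t \<in> M" for t
    using r(1)[OF that] that
    by (auto simp: e_def homogeneous_def in_keys_iff lookup_minus lookup_single when_def M_def mons_def
        subset_iff split: if_splits)
  have comb_lookup: "Poly_Mapping.lookup (\<Sum>t\<in>M. scale_poly (c t) (e t)) s = c s" if "s \<in> M" for c s
  proof -
    have "Poly_Mapping.lookup (\<Sum>t\<in>M. scale_poly (c t) (e t)) s = (\<Sum>t\<in>M. if s = t then c t else 0)"
      unfolding lookup_sum lookup_scale_poly
      by (intro sum.cong refl) (simp add: e_lookup that)
    then show ?thesis using that finM by simp
  qed
  have inj: "inj_on e M"
  proof (rule inj_onI)
    fix s t assume "s \<in> M" "t \<in> M" "e s = e t"
    then show "s = t" using e_lookup[of s s] e_lookup[of t s] by (auto split: if_splits)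
  qed
  have "poly_vs.dim {f \<in> J. homogeneous d f} = card (e ` M)"
  proof (rule poly_vs.dim_unique[OF _ _ _ refl])
    show "e ` M \<subseteq> {f \<in> J. homogeneous d f}" using eJ e_hom by auto
    show "{f \<in> J. homogeneous d f} \<subseteq> poly_vs.span (e ` M)"
    proof clarify
      fix f assume f: "f \<in> J" "homogeneous d f"
      define g where "g = (\<Sum>t\<in>M. scale_poly (Poly_Mapping.lookup f t) (e t))"
      have "g \<in> J" unfolding g_def by (intro poly_vs.subspace_sum[OF subspace] scale_mem eJ)
      then have "f - g \<in> J" using f(1) by (intro diff_mem)
      moreover have "Poly_Mapping.keys (f - g) \<subseteq> mons n d - initial_monomials n w J"
      proof -
        have "homogeneous d (f + scale_poly (-1) g)"
          unfolding g_def by (intro homogeneous_add f(2) homogeneous_scale homogeneous_sum e_hom)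
        then have "homogeneous d (f - g)" by simp
        then have "Poly_Mapping.keys (f - g) \<subseteq> mons n d" by (rule keys_in_mons[OF \<open>f - g \<in> J\<close>])
        moreover have "Poly_Mapping.lookup (f - g) s = 0" if "s \<in> M" for s
          unfolding lookup_minus g_def comb_lookup[OF that] by simp
        ultimately show ?thesis by (auto simp: M_def in_keys_iff)
      qed
      ultimately have "f - g = 0"
        using free_disjoint_initial_monomials[of "mons n d - initial_monomials n w J" w]
        unfolding free_monomials_def by blast
      then have "f = g" by simp
      moreover have "g \<in> poly_vs.span (e ` M)"
        unfolding g_def by (intro poly_vs.span_sum poly_vs.span_scale poly_vs.span_base imageI)
      ultimately show "f \<in> poly_vs.span (e ` M)" by simp
    qed
    show "poly_vs.independent (e ` M)"
    proof
      assume "poly_vs.dependent (e ` M)"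
      then obtain u where u: "\<exists>v\<in>e ` M. u v \<noteq> 0" "(\<Sum>v\<in>e ` M. scale_poly (u v) v) = 0"
        using poly_vs.dependent_finite[OF finite_imageI[OF finM, of e]] by blast
      then have "(\<Sum>t\<in>M. scale_poly (u (e t)) (e t)) = 0" by (simp add: sum.reindex[OF inj])
      then have "u (e s) = 0" if "s \<in> M" for s using comb_lookup[OF that, of "\<lambda>t. u (e t)"] by simp
      then show False using u(1) by auto
    qed
  qed
  then show ?thesis unfolding card_image[OF inj] M_def[symmetric] by simp
qed

end

text \<open>
  Induction along the order on monomials of degree \<open>d\<close>: the greedy criterion for a monomial refers only to
  free sets and to the standard monomials below it.
\<close>

lemma initial_monomials_determined_by_free:
  assumes J: "graded_polynomial_ideal n J" and J': "graded_polynomial_ideal n J'"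
    and free: "\<And>A. A \<subseteq> mons n d \<Longrightarrow> free_monomials J A \<longleftrightarrow> free_monomials J' A"
  shows "initial_monomials n w J \<inter> mons n d = initial_monomials n w J' \<inter> mons n d"
proof -
  have "m \<in> initial_monomials n w J \<longleftrightarrow> m \<in> initial_monomials n w J'" if "m \<in> mons n d" for m
    using that
  proof (induction "card {b \<in> mons n d. weight_less n w b m}" arbitrary: m rule: less_induct)
    case less
    have "b \<in> initial_monomials n w J \<longleftrightarrow> b \<in> initial_monomials n w J'"
      if b: "b \<in> mons n d" "weight_less n w b m" for b
    proof (rule less.hyps[OF _ b(1)])
      have "{a \<in> mons n d. weight_less n w a b} \<subset> {a \<in> mons n d. weight_less n w a m}"
        using b weight_less_trans weight_less_irrefl by blast
      then show "card {a \<in> mons n d. weight_less n w a b} < card {a \<in> mons n d. weight_less n w a m}"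
        by (rule psubset_card_mono[rotated]) (simp add: finite_mons)
    qed
    then have "{b \<in> mons n d - initial_monomials n w J. weight_less n w b m} =
        {b \<in> mons n d - initial_monomials n w J'. weight_less n w b m}" by blast
    then show ?case
      using graded_polynomial_ideal.standard_iff_free[OF J less.prems, of w]
        graded_polynomial_ideal.standard_iff_free[OF J' less.prems, of w]
        free[of "insert m {b \<in> mons n d - initial_monomials n w J'. weight_less n w b m}"] less.prems
      by auto
  qed
  then show ?thesis by blast
qed

lemma graded_polynomial_idealI:
  assumes "graded_ideal n J"
  shows "graded_polynomial_ideal n J"
proof -
  interpret I: ideal J "poly_ring n" using assms by (simp add: graded_ideal_def)
  show ?thesis
  proof
    show "J \<subseteq> polys n" using I.a_subset by (simp add: poly_ring_def)
    show "0 \<in> J" using additive_subgroup.zero_closed[OF I.additive_subgroup_axioms] by (simp add: poly_ring_def)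
    show "f + g \<in> J" if "f \<in> J" "g \<in> J" for f g
      using additive_subgroup.a_closed[OF I.additive_subgroup_axioms that] by (simp add: poly_ring_def)
    show "h * f \<in> J" if "f \<in> J" "h \<in> polys n" for f h
      using I.I_l_closed[OF that(1)] that(2) by (simp add: poly_ring_def)
    show "homogeneous_component d f \<in> J" if "f \<in> J" for f d
      using assms that by (simp add: graded_ideal_def)
  qed
qed

section \<open>Polynomial families of polynomials\<close>

text \<open>
  Polynomials whose coefficients depend polynomially on the endomorphism \<open>g\<close>. Generating them from
  monomials makes closure under products and evaluation by functionals simple inductions.
\<close>

inductive_set polynomial_families ::
    "('k::field \<Rightarrow> 'v::ab_group_add \<Rightarrow> 'v) \<Rightarrow> (('v \<Rightarrow> 'v) \<Rightarrow> 'k mpoly) set"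
  for smul :: "'k::field \<Rightarrow> 'v::ab_group_add \<Rightarrow> 'v" where
  single: "p \<in> polynomial_functions smul \<Longrightarrow> (\<lambda>g. Poly_Mapping.single m (p g)) \<in> polynomial_families smul"
| add: "F \<in> polynomial_families smul \<Longrightarrow> G \<in> polynomial_families smul \<Longrightarrow>
    (\<lambda>g. F g + G g) \<in> polynomial_families smul"

lemma polynomial_families_const: "(\<lambda>g. Poly_Mapping.single m c) \<in> polynomial_families smul"
  by (rule polynomial_families.single[OF polynomial_functions.const])

lemma polynomial_families_mult:
  assumes "F \<in> polynomial_families smul" "G \<in> polynomial_families smul"
  shows "(\<lambda>g. F g * G g) \<in> polynomial_families smul"
  using assms
proof (induction arbitrary: G)
  case (single p m)
  from single(2) show ?case
  proof induction
    case (single q m')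
    then show ?case
      using polynomial_families.single[OF polynomial_functions.mult[OF \<open>p \<in> _\<close> single]]
      by (simp add: mult_single)
  next
    case (add F G)
    then show ?case using polynomial_families.add[OF add.IH] by (simp add: distrib_left)
  qed
next
  case (add F F')
  then show ?case
    using polynomial_families.add[OF add.IH(1)[OF add.prems] add.IH(2)[OF add.prems]]
    by (simp add: distrib_right)
qed

lemma polynomial_families_sum:
  assumes "\<And>a. a \<in> A \<Longrightarrow> F a \<in> polynomial_families smul"
  shows "(\<lambda>g. \<Sum>a\<in>A. F a g) \<in> polynomial_families smul"
  using assms
proof (induction A rule: infinite_finite_induct)
  case (insert a A)
  then have "(\<lambda>g. F a g + (\<Sum>a\<in>A. F a g)) \<in> polynomial_families smul"
    by (intro polynomial_families.add) auto
  then show ?case using insert.hyps by simp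
qed (use polynomial_families_const[of 0 0 smul] in simp_all)

lemma polynomial_families_prod:
  assumes "\<And>a. a \<in> A \<Longrightarrow> F a \<in> polynomial_families smul"
  shows "(\<lambda>g. \<Prod>a\<in>A. F a g) \<in> polynomial_families smul"
  using assms
proof (induction A rule: infinite_finite_induct)
  case (insert a A)
  then have "(\<lambda>g. F a g * (\<Prod>a\<in>A. F a g)) \<in> polynomial_families smul"
    by (intro polynomial_families_mult) auto
  then show ?case using insert.hyps by simp
qed (use polynomial_families_const[of 0 1 smul] in simp_all)

lemma polynomial_families_power:
  assumes "F \<in> polynomial_families smul"
  shows "(\<lambda>g. F g ^ k) \<in> polynomial_families smul"
  using polynomial_families_prod[of "{..<k}" "\<lambda>_. F" smul] assms by simp

lemma polynomial_families_functional:
  assumes "F \<in> polynomial_families smul" and \<phi>: "Vector_Spaces.linear scale_poly (*) \<phi>"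
  shows "(\<lambda>g. \<phi> (F g)) \<in> polynomial_functions smul"
  using assms(1)
proof induction
  interpret \<phi>: Vector_Spaces.linear scale_poly "(*)" \<phi> by (rule \<phi>)
  case (single p m)
  have "\<phi> (Poly_Mapping.single m (p g)) = p g * \<phi> (Poly_Mapping.single m 1)" for g
    using \<phi>.scale[of "p g" "Poly_Mapping.single m 1"] by simp
  then show ?case
    using polynomial_functions.mult[OF single polynomial_functions.const] by simp
next
  interpret \<phi>: Vector_Spaces.linear scale_poly "(*)" \<phi> by (rule \<phi>)
  case (add F G)
  then show ?case using polynomial_functions.add[OF add.IH] by (simp add: \<phi>.add)
qed

section \<open>The action of the general linear group\<close>

global_interpretation dual_vs: vector_space dual_scale
  by unfold_locales (auto simp: dual_scale_def fun_eq_iff algebra_simps)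

locale dual_coordinates = finite_dimensional_vector_space scale Basis
  for scale :: "'k::field \<Rightarrow> 'v::ab_group_add \<Rightarrow> 'v" and Basis +
  fixes n :: nat and x :: "nat \<Rightarrow> 'v \<Rightarrow> 'k"
  assumes dual_basis: "basis_of_dual scale n x"
begin

abbreviation coord :: "('v \<Rightarrow> 'k) \<Rightarrow> nat \<Rightarrow> 'k" where
  "coord \<xi> i \<equiv> dual_vs.representation (x ` {..<n}) \<xi> (x i)"

text \<open>
  Precomposition with \<open>g\<close>, the inverse of the action of \<open>g\<close>. The action itself involves the inverse of
  \<open>g\<close>, whose entries are only rational functions on \<open>GL(V)\<close>; the pullback is polynomial in \<open>g\<close>.
\<close>

definition pullback :: "('v \<Rightarrow> 'v) \<Rightarrow> 'k mpoly \<Rightarrow> 'k mpoly" where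
  "pullback g = poly_subst (\<lambda>j. linear_form n x (x j \<circ> g))"

lemma x_inj: "inj_on x {..<n}" and x_independent: "dual_vs.independent (x ` {..<n})"
  and x_span: "dual_vs.span (x ` {..<n}) = dual scale"
  using dual_basis by (simp_all add: basis_of_dual_def)

lemma x_dual: "i < n \<Longrightarrow> x i \<in> dual scale"
  unfolding x_span[symmetric] by (rule dual_vs.span_base) simp

lemma dual_comp: "\<xi> \<in> dual scale \<Longrightarrow> Vector_Spaces.linear scale scale g \<Longrightarrow> \<xi> \<circ> g \<in> dual scale"
  unfolding dual_def mem_Collect_eq by (rule Vector_Spaces.linear_compose)

lemma dual_expansion:
  assumes "\<xi> \<in> dual scale"
  shows "\<xi> = (\<Sum>i<n. dual_scale (coord \<xi> i) (x i))"
proof -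
  have "(\<Sum>\<eta>\<in>x ` {..<n}. dual_scale (dual_vs.representation (x ` {..<n}) \<xi> \<eta>) \<eta>) = \<xi>"
    using assms by (intro dual_vs.sum_representation_eq) (auto simp: x_independent x_span)
  then show ?thesis by (simp add: sum.reindex[OF x_inj])
qed

lemma linear_form_eq: "linear_form n x \<xi> =
    (\<Sum>i<n. Poly_Mapping.single (Poly_Mapping.single i 1) (coord \<xi> i))"
  by (simp add: linear_form_def)

lemma single_sum: "Poly_Mapping.single m (\<Sum>a\<in>A. c a) = (\<Sum>a\<in>A. Poly_Mapping.single m (c a))"
  by (induction A rule: infinite_finite_induct) (simp_all add: single_add)

lemma sum_fun_apply: "(\<Sum>a\<in>A. f a) v = (\<Sum>a\<in>A. f a v)"
  by (induction A rule: infinite_finite_induct) simp_all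

lemma linear_form_sum:
  assumes "\<And>a. a \<in> A \<Longrightarrow> \<xi> a \<in> dual scale"
  shows "linear_form n x (\<Sum>a\<in>A. dual_scale (c a) (\<xi> a)) = (\<Sum>a\<in>A. scale_poly (c a) (linear_form n x (\<xi> a)))"
proof -
  have "coord (\<Sum>a\<in>A. dual_scale (c a) (\<xi> a)) i = (\<Sum>a\<in>A. c a * coord (\<xi> a) i)" for i
    using assms
    by (subst dual_vs.representation_sum)
       (auto simp: x_independent x_span dual_vs.representation_scale
         intro!: dual_vs.span_scale[of _ "x ` {..<n}", unfolded x_span])
  then show ?thesis
    unfolding linear_form_eq poly_vs.scale_sum_right
    by (subst sum.swap) (simp add: single_sum)
qed

lemma linear_form_x: "i < n \<Longrightarrow> linear_form n x (x i) = Poly_Mapping.single (Poly_Mapping.single i 1) 1"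
proof -
  assume i: "i < n"
  then have "coord (x i) j = (if j = i then 1 else 0)" if "j < n" for j
    using that inj_onD[OF x_inj] by (auto simp: dual_vs.representation_basis[OF x_independent])
  then have "linear_form n x (x i) =
      (\<Sum>j<n. if j = i then Poly_Mapping.single (Poly_Mapping.single i 1) 1 else 0)"
    unfolding linear_form_eq by (intro sum.cong) auto
  then show ?thesis using i by simp
qed

lemma linear_form_polys: "linear_form n x \<xi> \<in> polys n"
  unfolding linear_form_eq by (intro polys_sum polys_single) auto

lemma linear_form_homogeneous: "homogeneous 1 (linear_form n x \<xi>)"
  unfolding linear_form_eq
  by (intro homogeneous_sum) (simp add: homogeneous_def total_degree_def)

lemma pullback_linear_form:
  assumes g: "Vector_Spaces.linear scale scale g" and \<xi>: "\<xi> \<in> dual scale"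
  shows "pullback g (linear_form n x \<xi>) = linear_form n x (\<xi> \<circ> g)"
proof -
  have "\<xi> \<circ> g = (\<Sum>i<n. dual_scale (coord \<xi> i) (x i)) \<circ> g"
    by (rule arg_cong[OF dual_expansion[OF \<xi>]])
  also have "\<dots> = (\<Sum>i<n. dual_scale (coord \<xi> i) (x i \<circ> g))"
    by (simp add: fun_eq_iff dual_scale_def sum_fun_apply)
  finally have "linear_form n x (\<xi> \<circ> g) = (\<Sum>i<n. scale_poly (coord \<xi> i) (linear_form n x (x i \<circ> g)))"
    using linear_form_sum[of "{..<n}" "\<lambda>i. x i \<circ> g"] dual_comp[OF x_dual g] by simp
  then show ?thesis
    unfolding linear_form_eq[of \<xi>] by (simp add: pullback_def poly_subst_sum poly_subst_single del: One_nat_def)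
qed

lemma pullback_pullback:
  assumes "Vector_Spaces.linear scale scale g" "Vector_Spaces.linear scale scale h" "f \<in> polys n"
  shows "pullback g (pullback h f) = pullback (h \<circ> g) f"
proof -
  have "pullback g (pullback h f) = poly_subst (\<lambda>j. pullback g (linear_form n x (x j \<circ> h))) f"
    unfolding pullback_def by (rule poly_subst_subst)
  also have "\<dots> = pullback (h \<circ> g) f"
    unfolding pullback_def[of "h \<circ> g"] using assms
    by (intro poly_subst_cong[where n = n])
       (simp_all add: pullback_linear_form dual_comp x_dual o_assoc)
  finally show ?thesis .
qed

lemma pullback_id: "f \<in> polys n \<Longrightarrow> pullback id f = f"
proof -
  assume "f \<in> polys n"
  then have "pullback id f = poly_subst (\<lambda>j. Poly_Mapping.single (Poly_Mapping.single j 1) 1) f"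
    unfolding pullback_def by (intro poly_subst_cong[where n = n]) (simp_all add: linear_form_x del: One_nat_def)
  then show ?thesis by (simp only: poly_subst_vars)
qed

lemma pullback_polys: "pullback g f \<in> polys n"
  unfolding pullback_def by (intro polys_subst linear_form_polys)

lemma pullback_component:
  "homogeneous_component d (pullback g f) = pullback g (homogeneous_component d f)"
  unfolding pullback_def by (intro homogeneous_component_subst linear_form_homogeneous)

lemma GL_act_pullback: "GL_act n x g = pullback (inv_into UNIV g)"
  by (simp add: GL_act_def pullback_def)

lemma GL_inv:
  assumes "g \<in> GL scale"
  shows "inv_into UNIV g \<in> GL scale" "inv_into UNIV g \<circ> g = id" "g \<circ> inv_into UNIV g = id"
proof -
  have g: "Vector_Spaces.linear scale scale g" "bij g" using assms by (simp_all add: GL_def)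
  interpret g: Vector_Spaces.linear scale scale g by (rule g(1))
  have gi: "g (inv_into UNIV g v) = v" for v using g(2) by (simp add: bij_is_surj surj_f_inv_f)
  have gI: "inv_into UNIV g v = w" if "g w = v" for v w using that g(2) by (auto simp: bij_is_inj)
  have "Vector_Spaces.linear scale scale (inv_into UNIV g)"
    by (intro vector_space_linearI vector_space_axioms) (auto intro!: gI simp: g.add g.scale gi)
  then show "inv_into UNIV g \<in> GL scale" using g(2) by (simp add: GL_def bij_imp_bij_inv)
  show "inv_into UNIV g \<circ> g = id" "g \<circ> inv_into UNIV g = id" using g(2) gi by (auto simp: bij_is_inj fun_eq_iff)
qed

text \<open>
  The action of \<open>g\<close> and the pullback along \<open>g\<close> are mutually inverse on the polynomial ring.
\<close>

lemma GL_act_image: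
  assumes g: "g \<in> GL scale" and I: "I \<subseteq> polys n"
  shows "GL_act n x g ` I = {f \<in> polys n. pullback g f \<in> I}"
proof -
  have lin: "Vector_Spaces.linear scale scale g" "Vector_Spaces.linear scale scale (inv_into UNIV g)"
    using g GL_inv[OF g] by (simp_all add: GL_def)
  have "pullback g (pullback (inv_into UNIV g) f) = f" "pullback (inv_into UNIV g) (pullback g f) = f" if "f \<in> polys n" for f
    using that by (simp_all add: pullback_pullback lin GL_inv[OF g] pullback_id)
  then show ?thesis unfolding GL_act_pullback using I pullback_polys by (auto intro!: image_eqI)
qed

lemma pullback_inj:
  assumes g: "g \<in> GL scale" and f: "f \<in> polys n" and "pullback g f = 0"
  shows "f = 0"
proof -
  have lin: "Vector_Spaces.linear scale scale g" "Vector_Spaces.linear scale scale (inv_into UNIV g)"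
    using g GL_inv[OF g] by (simp_all add: GL_def)
  have "pullback (inv_into UNIV g) (pullback g f) = f"
    using f by (simp add: pullback_pullback lin GL_inv[OF g] pullback_id)
  then show ?thesis using assms(3) by (simp add: pullback_def)
qed

text \<open>
  On linear maps, \<open>\<xi> \<circ> g\<close> is the combination of the coordinate functions \<open>bstar b\<close> of a basis of \<open>V\<close>
  with the coefficients \<open>\<xi> (g b)\<close>. This exhibits its coordinates as polynomial
  functions of \<open>g\<close>. For nonlinear \<open>g\<close> the combination need not equal \<open>\<xi> \<circ> g\<close>.
\<close>

lemma pullback_family:
  assumes m: "Poly_Mapping.keys m \<subseteq> {..<n}"
  shows "\<exists>F\<in>polynomial_families scale. \<forall>g. Vector_Spaces.linear scale scale g \<longrightarrow>
    F g = pullback g (Poly_Mapping.single m 1)"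
proof -
  define bstar where "bstar b = (\<lambda>v. representation Basis v b)" for b
  have bstar: "bstar b \<in> dual scale" for b
    unfolding dual_def bstar_def
    by (intro CollectI vector_space_linearI vector_space_axioms vector_space_field)
       (simp_all add: independent_Basis span_Basis representation_add representation_scale)
  define lin where "lin j g = (\<Sum>i<n. Poly_Mapping.single (Poly_Mapping.single i (1::nat))
      (\<Sum>b\<in>Basis. x j (g b) * coord (bstar b) i))" for j g
  have lin_family: "lin j \<in> polynomial_families scale" if "j < n" for j
  proof -
    have "(\<lambda>g. x j (g b) * coord (bstar b) i) \<in> polynomial_functions scale" for b i
      by (rule polynomial_functions.mult[OF polynomial_functions.entry[OF x_dual[OF that]]
            polynomial_functions.const])
    then show ?thesis
      unfolding lin_def[abs_def]
      by (intro polynomial_families_sum polynomial_families.single polynomial_functions_sum)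
  qed
  have lin_eq: "lin j g = linear_form n x (x j \<circ> g)"
    if j: "j < n" and g: "Vector_Spaces.linear scale scale g" for j and g :: "'v \<Rightarrow> 'v"
  proof -
    define \<xi> :: "'v \<Rightarrow> 'k" where "\<xi> = x j \<circ> g"
    have \<xi>: "\<xi> \<in> dual scale" unfolding \<xi>_def by (rule dual_comp[OF x_dual[OF j] g])
    interpret \<xi>: Vector_Spaces.linear scale "(*)" \<xi> using \<xi> by (simp add: dual_def)
    have expand: "\<xi> v = (\<Sum>b\<in>Basis. \<xi> b * representation Basis v b)" for v
    proof -
      have "v = (\<Sum>b\<in>Basis. scale (representation Basis v b) b)"
        by (rule sum_representation_eq[symmetric]) (auto simp: independent_Basis span_Basis finite_Basis)
      then have "\<xi> v = \<xi> (\<Sum>b\<in>Basis. scale (representation Basis v b) b)" by (rule arg_cong)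
      then show ?thesis by (simp add: \<xi>.sum \<xi>.scale mult.commute)
    qed
    have "\<xi> = (\<Sum>b\<in>Basis. dual_scale (\<xi> b) (bstar b))"
      unfolding fun_eq_iff sum_fun_apply dual_scale_def bstar_def by (intro allI expand)
    then have "linear_form n x \<xi> = linear_form n x (\<Sum>b\<in>Basis. dual_scale (\<xi> b) (bstar b))"
      by (rule arg_cong)
    also have "\<dots> = (\<Sum>b\<in>Basis. scale_poly (\<xi> b) (linear_form n x (bstar b)))"
      by (rule linear_form_sum[OF bstar])
    also have "\<dots> = lin j g"
      unfolding lin_def linear_form_eq poly_vs.scale_sum_right
      by (subst sum.swap) (simp add: single_sum \<xi>_def)
    finally show ?thesis by (simp add: \<xi>_def)
  qed
  define F where "F g = (\<Prod>i\<in>Poly_Mapping.keys m. lin i g ^ Poly_Mapping.lookup m i)" for g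
  have "F \<in> polynomial_families scale"
    unfolding F_def[abs_def] using m
    by (intro polynomial_families_prod polynomial_families_power lin_family) auto
  moreover have "F g = pullback g (Poly_Mapping.single m 1)"
    if g: "Vector_Spaces.linear scale scale g" for g
  proof -
    have "lin i g = linear_form n x (x i \<circ> g)" if "i \<in> Poly_Mapping.keys m" for i
      using that m g by (intro lin_eq) auto
    then have "F g = (\<Prod>i\<in>Poly_Mapping.keys m. linear_form n x (x i \<circ> g) ^ Poly_Mapping.lookup m i)"
      unfolding F_def by (intro prod.cong) simp_all
    then show ?thesis
      unfolding pullback_def poly_subst_single monomial_subst_def poly_vs.scale_one .
  qed
  ultimately show ?thesis by (intro bexI[of _ F] allI impI)
qed

end

section \<open>Genericity\<close>

text \<open>
  The vectors \<open>u a\<close> can be added to \<open>C\<close> one at a time; none lies in the span of those added before.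
\<close>

lemma (in vector_space) independent_insert_image:
  assumes "finite A" "independent C" "\<And>a. a \<in> A \<Longrightarrow> u a \<notin> span (C \<union> u ` (A - {a}))"
  shows "independent (C \<union> u ` A)"
  using assms(1,3)
proof (induction A rule: finite_induct)
  case empty
  then show ?case using assms(2) by simp
next
  case (insert a A)
  have "u b \<notin> span (C \<union> u ` (A - {b}))" if "b \<in> A" for b
    using insert.prems[of b] that span_mono[of "C \<union> u ` (A - {b})" "C \<union> u ` (insert a A - {b})"] by blast
  then have "independent (C \<union> u ` A)" by (rule insert.IH)
  moreover have "u a \<notin> span (C \<union> u ` A)" using insert.prems[of a] insert.hyps by simp
  ultimately show ?case by (simp add: independent_insertI)
qed

context dual_coordinates
begin

text \<open>
  The image of \<open>I\<close> under the action of \<open>g\<close>, see \<open>GL_act_image\<close>; in this form, membership is polynomial in \<open>g\<close>.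
\<close>

definition translate :: "'k mpoly set \<Rightarrow> ('v \<Rightarrow> 'v) \<Rightarrow> 'k mpoly set" where
  "translate I g = {f \<in> polys n. pullback g f \<in> I}"

lemma pullback_linear: "Vector_Spaces.linear scale_poly scale_poly (pullback g)"
  unfolding pullback_def by (rule poly_subst_linear)

lemma translate_graded_ideal:
  assumes "graded_polynomial_ideal n I"
  shows "graded_polynomial_ideal n (translate I g)"
proof -
  interpret I: graded_polynomial_ideal n I by (rule assms)
  interpret g: Vector_Spaces.linear scale_poly scale_poly "pullback g" by (rule pullback_linear)
  have mult: "pullback g (h * f) = pullback g h * pullback g f" for h f
    unfolding pullback_def by (rule poly_subst_mult)
  have comp: "homogeneous_component d f \<in> polys n" if "f \<in> polys n" for f :: "'k mpoly" and d
    using that by (auto simp: polys_def in_keys_iff lookup_homogeneous_component split: if_splits)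
  show ?thesis
    by unfold_locales
       (auto simp: translate_def g.zero g.add mult polys_plus polys_times comp I.zero_mem I.add_mem
         pullback_polys I.mult_mem I.component_mem simp flip: pullback_component)
qed

text \<open>
  The pullback along \<open>g\<close> maps the degree \<open>d\<close> part of the translate isomorphically onto that of \<open>I\<close>.
\<close>

lemma translate_hilbert_function:
  assumes I: "I \<subseteq> polys n" and g: "g \<in> GL scale"
  shows "poly_vs.dim {f \<in> translate I g. homogeneous d f} = poly_vs.dim {f \<in> I. homogeneous d f}"
    (is "poly_vs.dim ?J = poly_vs.dim ?I")
proof -
  have lin: "Vector_Spaces.linear scale scale g" "Vector_Spaces.linear scale scale (inv_into UNIV g)"
    using g GL_inv[OF g] by (simp_all add: GL_def)
  interpret T: Vector_Spaces.linear scale_poly scale_poly "pullback g" by (rule pullback_linear)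
  have hom: "homogeneous d (pullback h f)" if "homogeneous d f" for h f
    using pullback_component[of d h f] homogeneous_component_homogeneous[of d "pullback h f"]
    by (simp add: homogeneous_component_of_homogeneous[OF that])
  obtain B where B: "B \<subseteq> ?J" "poly_vs.independent B" "?J \<subseteq> poly_vs.span B" "card B = poly_vs.dim ?J"
    using poly_vs.basis_exists by blast
  have polys_subspace: "poly_vs.subspace (polys n :: 'k mpoly set)"
    by (intro poly_vs.subspaceI polys_zero polys_plus polys_scale)
  have span_polys: "poly_vs.span B \<subseteq> polys n"
    using B(1) by (intro poly_vs.span_minimal polys_subspace) (auto simp: translate_def)
  have inj: "inj_on (pullback g) (poly_vs.span B)"
  proof (rule inj_onI)
    fix f f' assume f: "f \<in> poly_vs.span B" "f' \<in> poly_vs.span B" "pullback g f = pullback g f'"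
    then have "f - f' \<in> polys n" using poly_vs.span_diff[OF f(1,2)] span_polys by blast
    moreover have "pullback g (f - f') = 0" using f(3) by (simp add: T.diff)
    ultimately show "f = f'" using pullback_inj[OF g, of "f - f'"] by simp
  qed
  have "poly_vs.dim ?I = card (pullback g ` B)"
  proof (rule poly_vs.dim_unique[OF _ _ _ refl])
    show "pullback g ` B \<subseteq> ?I" using B(1) hom by (auto simp: translate_def)
    show "poly_vs.independent (pullback g ` B)"
      using B(2) inj by (rule T.independent_injective_image)
    show "?I \<subseteq> poly_vs.span (pullback g ` B)"
    proof
      fix f assume f: "f \<in> ?I"
      then have fp: "f \<in> polys n" using I by blast
      have eq: "pullback g (pullback (inv_into UNIV g) f) = f"
        using fp by (simp add: pullback_pullback lin GL_inv[OF g] pullback_id)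
      then have "pullback (inv_into UNIV g) f \<in> ?J"
        using f hom by (simp add: translate_def pullback_polys)
      then have "pullback g (pullback (inv_into UNIV g) f) \<in> pullback g ` poly_vs.span B"
        using B(3) by blast
      then show "f \<in> poly_vs.span (pullback g ` B)" by (simp only: eq T.span_image)
    qed
  qed
  also have "\<dots> = card B"
    by (rule card_image[OF inj_on_subset[OF inj poly_vs.span_superset]])
  finally show ?thesis using B(4) by simp
qed

text \<open>
  Freeness says that the pullbacks of the monomials in \<open>A\<close>, added to a basis \<open>C\<close> of \<open>I\<close>, are linearly
  independent; so functionals with prescribed values on them exist.
\<close>

lemma free_separating_functionals:
  assumes I: "poly_vs.subspace I"
    and A: "finite A" "\<And>m. m \<in> A \<Longrightarrow> Poly_Mapping.keys m \<subseteq> {..<n}"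
    and free: "free_monomials (translate I g) A"
  obtains \<phi> where "\<And>a. Vector_Spaces.linear scale_poly (*) (\<phi> a)"
    "\<And>a f. f \<in> I \<Longrightarrow> \<phi> a f = 0"
    "\<And>a b. a \<in> A \<Longrightarrow> b \<in> A \<Longrightarrow> \<phi> a (pullback g (Poly_Mapping.single b 1)) = (if b = a then 1 else 0)"
proof -
  interpret T: Vector_Spaces.linear scale_poly scale_poly "pullback g" by (rule pullback_linear)
  interpret k: vector_space_pair scale_poly "(*) :: 'k \<Rightarrow> 'k \<Rightarrow> 'k"
    by (intro vector_space_pair.intro vector_space_field poly_vs.vector_space_axioms)
  define u where "u m = pullback g (Poly_Mapping.single m 1)" for m
  obtain C where C: "C \<subseteq> I" "poly_vs.independent C" "I \<subseteq> poly_vs.span C"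
    using poly_vs.maximal_independent_subset by blast
  have span_C: "poly_vs.span C \<subseteq> I" using C(1) I by (rule poly_vs.span_minimal)
  \<comment> \<open>A relation between pullbacks modulo \<open>I\<close> pulls back from an element of the translate supported on \<open>A\<close>.\<close>
  have outside: "u a \<notin> poly_vs.span (C \<union> u ` (A - {a}))" if a: "a \<in> A" for a
  proof
    assume "u a \<in> poly_vs.span (C \<union> u ` (A - {a}))"
    then obtain f h' where f: "f \<in> poly_vs.span C" "h' \<in> poly_vs.span (u ` (A - {a}))" "u a = f + h'"
      unfolding poly_vs.span_Un by blast
    let ?S = "(\<lambda>m. Poly_Mapping.single m (1::'k)) ` (A - {a})"
    have "u ` (A - {a}) = pullback g ` ?S" by (simp add: u_def image_image)
    then obtain h where h: "h \<in> poly_vs.span ?S" "h' = pullback g h"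
      using f(2) by (auto simp: T.span_image)
    have sub: "poly_vs.subspace {p :: 'k mpoly. Poly_Mapping.keys p \<subseteq> A - {a}}"
    proof (rule poly_vs.subspaceI)
      show "p + q \<in> {p. Poly_Mapping.keys p \<subseteq> A - {a}}"
        if "p \<in> {p. Poly_Mapping.keys p \<subseteq> A - {a}}" "q \<in> {p. Poly_Mapping.keys p \<subseteq> A - {a}}" for p q :: "'k mpoly"
        using that Poly_Mapping.keys_add[of p q] by auto
      show "scale_poly c p \<in> {p. Poly_Mapping.keys p \<subseteq> A - {a}}"
        if "p \<in> {p. Poly_Mapping.keys p \<subseteq> A - {a}}" for c and p :: "'k mpoly"
        using that keys_scale_poly[of c p] by auto
    qed simp
    have "poly_vs.span ?S \<subseteq> {p. Poly_Mapping.keys p \<subseteq> A - {a}}"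
      by (rule poly_vs.span_minimal[OF _ sub]) auto
    then have keys_h: "Poly_Mapping.keys h \<subseteq> A - {a}" using h(1) by blast
    define p where "p = Poly_Mapping.single a 1 - h"
    have keys_p: "Poly_Mapping.keys p \<subseteq> A"
      using keys_h a by (auto simp: p_def in_keys_iff lookup_minus lookup_single when_def subset_iff split: if_splits)
    have "pullback g p = f" using f(3) h(2) by (simp add: p_def T.diff u_def)
    then have "pullback g p \<in> I" using f(1) span_C by blast
    moreover have "p \<in> polys n" using keys_p A(2) by (auto simp: polys_def)
    ultimately have "p = 0" using free keys_p unfolding free_monomials_def translate_def by blast
    moreover have "Poly_Mapping.lookup p a = 1"
      using keys_h by (auto simp: p_def lookup_minus in_keys_iff)
    ultimately show False by simp
  qed
  have ind: "poly_vs.independent (C \<union> u ` A)"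
    by (rule poly_vs.independent_insert_image[OF A(1) C(2) outside])
  have "\<exists>\<phi>. Vector_Spaces.linear scale_poly (*) \<phi> \<and> (\<forall>v\<in>C \<union> u ` A. \<phi> v = (if v = u a then 1 else 0))" for a
    by (rule k.linear_independent_extend[OF ind])
  then obtain \<psi> where \<psi>: "\<And>a. Vector_Spaces.linear scale_poly (*) (\<psi> a)"
    "\<And>a v. v \<in> C \<union> u ` A \<Longrightarrow> \<psi> a v = (if v = u a then 1 else 0)" by metis
  \<comment> \<open>For \<open>a \<notin> A\<close>, \<open>u a\<close> may lie in \<open>C\<close>, and then \<open>\<psi> a\<close> does not vanish on \<open>I\<close>.\<close>
  define \<phi> where "\<phi> a = (if a \<in> A then \<psi> a else (\<lambda>_. 0))" for a
  show ?thesis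
  proof (rule that[of \<phi>])
    show lin: "Vector_Spaces.linear scale_poly (*) (\<phi> a)" for a
      using \<psi>(1) k.linear_zero by (simp add: \<phi>_def)
    show "\<phi> a f = 0" if "f \<in> I" for a f
    proof (cases "a \<in> A")
      case True
      interpret \<phi>: Vector_Spaces.linear scale_poly "(*)" "\<phi> a" by (rule lin)
      have "\<phi> a v = 0" if "v \<in> C" for v
      proof -
        have "v \<noteq> u a" using outside[OF True] that poly_vs.span_base[of v "C \<union> u ` (A - {a})"] by auto
        then show ?thesis using \<psi>(2)[of v a] that True by (simp add: \<phi>_def)
      qed
      then show ?thesis using \<phi>.eq_0_on_span[of C f] C(3) that by blast
    qed (simp add: \<phi>_def)
    show "\<phi> a (pullback g (Poly_Mapping.single b 1)) = (if b = a then 1 else 0)"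
      if "a \<in> A" "b \<in> A" for a b
    proof -
      have "u b \<noteq> u a" if "b \<noteq> a"
        using outside[OF \<open>a \<in> A\<close>] \<open>b \<in> A\<close> that poly_vs.span_base[of "u b" "C \<union> u ` (A - {a})"] by auto
      then show ?thesis using \<psi>(2)[of "u b" a] that by (auto simp: \<phi>_def u_def)
    qed
  qed
qed

text \<open>
  Take functionals \<open>\<phi> a\<close> that separate the pullbacks along \<open>g\<close> modulo \<open>I\<close>. Evaluating them on the pullbacks along
  a varying \<open>h\<close> gives a square matrix whose entries are polynomial functions of \<open>h\<close> and which is the
  identity for \<open>h = g\<close>. If its determinant does not vanish at \<open>h\<close>, no nonzero combination of the pullbacks
  along \<open>h\<close> lies in \<open>I\<close>.
\<close>

lemma free_polynomial:
  assumes I: "poly_vs.subspace I"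
    and A: "finite A" "\<And>m. m \<in> A \<Longrightarrow> Poly_Mapping.keys m \<subseteq> {..<n}"
    and g: "g \<in> GL scale" and free: "free_monomials (translate I g) A"
  shows "\<exists>p\<in>polynomial_functions scale. p g \<noteq> 0 \<and>
    (\<forall>h\<in>GL scale. p h \<noteq> 0 \<longrightarrow> free_monomials (translate I h) A)"
proof -
  obtain \<phi> where \<phi>: "\<And>a. Vector_Spaces.linear scale_poly (*) (\<phi> a)"
    "\<And>a f. f \<in> I \<Longrightarrow> \<phi> a f = 0"
    "\<And>a b. a \<in> A \<Longrightarrow> b \<in> A \<Longrightarrow> \<phi> a (pullback g (Poly_Mapping.single b 1)) = (if b = a then 1 else 0)"
    using free_separating_functionals[OF I A free] by blast
  have "\<exists>F. F \<in> polynomial_families scale \<and> (\<forall>h. Vector_Spaces.linear scale scale h \<longrightarrow>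
      F h = pullback h (Poly_Mapping.single m 1))" if "m \<in> A" for m
    using pullback_family[OF A(2)[OF that]] by (simp add: Bex_def)
  then have "\<forall>m\<in>A. \<exists>F. F \<in> polynomial_families scale \<and> (\<forall>h. Vector_Spaces.linear scale scale h \<longrightarrow>
      F h = pullback h (Poly_Mapping.single m 1))" by blast
  from bchoice[OF this] obtain F where F: "\<forall>m\<in>A. F m \<in> polynomial_families scale \<and>
    (\<forall>h. Vector_Spaces.linear scale scale h \<longrightarrow> F m h = pullback h (Poly_Mapping.single m 1))" ..
  have entries: "(\<lambda>h. \<phi> a (F b h)) \<in> polynomial_functions scale" if "b \<in> A" for a b
    using F that by (intro polynomial_families_functional \<phi>(1)) blast
  obtain p where p: "p \<in> polynomial_functions scale"
    "\<And>h. p h \<noteq> 0 \<longleftrightarrow> (\<forall>u. (\<forall>a\<in>A. (\<Sum>b\<in>A. \<phi> a (F b h) * u b) = 0) \<longrightarrow> (\<forall>b\<in>A. u b = 0))"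
    using nonsingularity_polynomial[OF A(1), of "\<lambda>a b h. \<phi> a (F b h)" scale] entries by auto
  have lin: "Vector_Spaces.linear scale scale h" if "h \<in> GL scale" for h
    using that by (simp add: GL_def)
  have "p g \<noteq> 0"
    unfolding p(2)
  proof (intro allI impI ballI)
    fix u b assume u: "\<forall>a\<in>A. (\<Sum>b\<in>A. \<phi> a (F b g) * u b) = 0" and b: "b \<in> A"
    have "(\<Sum>c\<in>A. \<phi> b (F c g) * u c) = (\<Sum>c\<in>A. if c = b then u c else 0)"
      using F lin[OF g] \<phi>(3)[OF b] by (intro sum.cong) auto
    also have "\<dots> = u b" using A(1) b by simp
    finally show "u b = 0" using u b by simp
  qed
  moreover have "free_monomials (translate I h) A" if h: "h \<in> GL scale" and ph: "p h \<noteq> 0" for h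
    unfolding free_monomials_def
  proof (intro ballI impI)
    fix f assume f: "f \<in> translate I h" "Poly_Mapping.keys f \<subseteq> A"
    interpret T: Vector_Spaces.linear scale_poly scale_poly "pullback h" by (rule pullback_linear)
    have "(\<Sum>b\<in>A. \<phi> a (F b h) * Poly_Mapping.lookup f b) = 0" for a
    proof -
      interpret \<phi>: Vector_Spaces.linear scale_poly "(*)" "\<phi> a" by (rule \<phi>(1))
      have "pullback h f = pullback h (\<Sum>m\<in>A. scale_poly (Poly_Mapping.lookup f m) (Poly_Mapping.single m 1))"
        by (rule arg_cong[OF poly_expansion_superset[OF A(1) f(2)]])
      also have "\<dots> = (\<Sum>m\<in>A. scale_poly (Poly_Mapping.lookup f m) (F m h))"
        unfolding T.sum T.scale using F lin[OF h] by (intro sum.cong refl) simp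
      finally have "\<phi> a (pullback h f) = (\<Sum>m\<in>A. Poly_Mapping.lookup f m * \<phi> a (F m h))"
        by (simp add: \<phi>.sum \<phi>.scale)
      then show ?thesis using \<phi>(2) f(1) by (simp add: translate_def mult.commute)
    qed
    then have zero: "\<forall>b\<in>A. Poly_Mapping.lookup f b = 0" using ph unfolding p(2) by blast
    show "f = 0"
    proof (rule poly_mapping_eqI)
      show "Poly_Mapping.lookup f k = Poly_Mapping.lookup 0 k" for k
        using zero f(2) by (cases "k \<in> A") (auto simp: in_keys_iff)
    qed
  qed
  ultimately show ?thesis using p(1) by blast
qed

text \<open>
  Let \<open>D\<close> be the degree bound for the family of all sets of initial monomials of translates. There are finitely
  many sets \<open>A\<close> of monomials of a common degree at most \<open>D\<close>; for each one that is free for some group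
  element take a function as in \<open>free_polynomial\<close>. Where the product of these functions is nonzero, all these
  sets are free; the other sets of degree at most \<open>D\<close> are free for no group element.
\<close>

lemma generic_initial_monomials:
  assumes inf: "infinite (UNIV :: 'k set)" and I: "graded_polynomial_ideal n I"
  obtains p where "p \<in> polynomial_functions scale" "\<exists>g\<in>GL scale. p g \<noteq> 0"
    "\<And>g h w. g \<in> GL scale \<Longrightarrow> p g \<noteq> 0 \<Longrightarrow> h \<in> GL scale \<Longrightarrow> p h \<noteq> 0 \<Longrightarrow>
      initial_monomials n w (translate I g) = initial_monomials n w (translate I h)"
proof -
  interpret I: graded_polynomial_ideal n I by (rule I)
  note J = translate_graded_ideal[OF I]
  define F where "F = {initial_monomials n w (translate I g) | w g. g \<in> GL scale}"
  have "\<exists>D. \<forall>N\<in>F. \<forall>N'\<in>F. (\<forall>d\<le>D. N \<inter> mons n d = N' \<inter> mons n d) \<longrightarrow> N = N'"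
  proof (rule upsets_determined_in_bounded_degree)
    show "monomial_upset n N" if "N \<in> F" for N
      using that graded_polynomial_ideal.initial_monomials_upset[OF J] by (auto simp: F_def)
    show "card (N \<inter> mons n d) = poly_vs.dim {f \<in> I. homogeneous d f}" if "N \<in> F" for N d
      using that by (auto simp: F_def graded_polynomial_ideal.card_initial_monomials[OF J]
          translate_hilbert_function[OF I.subset_polys])
  qed
  then obtain D where D: "\<forall>N\<in>F. \<forall>N'\<in>F. (\<forall>d\<le>D. N \<inter> mons n d = N' \<inter> mons n d) \<longrightarrow> N = N'" ..
  define S where "S = {A. (\<exists>d\<le>D. A \<subseteq> mons n d) \<and> (\<exists>g\<in>GL scale. free_monomials (translate I g) A)}"
  have finS: "finite S"
    by (rule finite_subset[of _ "\<Union>d\<le>D. Pow (mons n d)"]) (auto simp: S_def finite_mons)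
  have "\<forall>A\<in>S. \<exists>p. p \<in> polynomial_functions scale \<and> (\<exists>g\<in>GL scale. p g \<noteq> 0) \<and>
      (\<forall>h\<in>GL scale. p h \<noteq> 0 \<longrightarrow> free_monomials (translate I h) A)"
  proof
    fix A assume "A \<in> S"
    then obtain d g where A: "A \<subseteq> mons n d" "g \<in> GL scale" "free_monomials (translate I g) A"
      by (auto simp: S_def)
    have "finite A" using A(1) finite_mons by (rule finite_subset)
    moreover have "Poly_Mapping.keys m \<subseteq> {..<n}" if "m \<in> A" for m using A(1) that by (auto simp: mons_def)
    ultimately have "\<exists>q\<in>polynomial_functions scale. q g \<noteq> 0 \<and>
        (\<forall>h\<in>GL scale. q h \<noteq> 0 \<longrightarrow> free_monomials (translate I h) A)"
      by (rule free_polynomial[OF I.subspace _ _ A(2,3)])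
    then obtain q where "q \<in> polynomial_functions scale"
      and "q g \<noteq> 0 \<and> (\<forall>h\<in>GL scale. q h \<noteq> 0 \<longrightarrow> free_monomials (translate I h) A)" ..
    with A(2) show "\<exists>p. p \<in> polynomial_functions scale \<and> (\<exists>g\<in>GL scale. p g \<noteq> 0) \<and>
      (\<forall>h\<in>GL scale. p h \<noteq> 0 \<longrightarrow> free_monomials (translate I h) A)"
      by (intro exI[of _ q]) auto
  qed
  from bchoice[OF this] obtain p where p: "\<forall>A\<in>S. p A \<in> polynomial_functions scale \<and>
      (\<exists>g\<in>GL scale. p A g \<noteq> 0) \<and>
      (\<forall>h\<in>GL scale. p A h \<noteq> 0 \<longrightarrow> free_monomials (translate I h) A)" ..
  define P where "P g = (\<Prod>A\<in>S. p A g)" for g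
  have P: "P \<in> polynomial_functions scale"
    unfolding P_def[abs_def] by (rule polynomial_functions_prod) (use p in simp)
  have nonzero: "\<exists>g\<in>GL scale. P g \<noteq> 0"
    unfolding P_def by (rule GL_finite_product_nonzero[OF inf finS]) (use p in simp_all)
  have const: "initial_monomials n w (translate I g) = initial_monomials n w (translate I h)"
    if g: "g \<in> GL scale" "P g \<noteq> 0" and h: "h \<in> GL scale" "P h \<noteq> 0" for g h w
  proof -
    have generic: "free_monomials (translate I l) A \<longleftrightarrow> A \<in> S"
      if "l \<in> GL scale" "P l \<noteq> 0" "d \<le> D" "A \<subseteq> mons n d" for l A d
    proof
      show "A \<in> S" if "free_monomials (translate I l) A"
        using that \<open>l \<in> GL scale\<close> \<open>d \<le> D\<close> \<open>A \<subseteq> mons n d\<close> unfolding S_def by blast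
      assume "A \<in> S"
      moreover from this have "p A l \<noteq> 0" using \<open>P l \<noteq> 0\<close> finS by (simp add: P_def)
      ultimately show "free_monomials (translate I l) A" using p \<open>l \<in> GL scale\<close> by simp
    qed
    have "initial_monomials n w (translate I g) \<inter> mons n d = initial_monomials n w (translate I h) \<inter> mons n d"
      if d: "d \<le> D" for d
      by (rule initial_monomials_determined_by_free[OF J J])
         (simp add: generic[OF g d] generic[OF h d])
    moreover have "initial_monomials n w (translate I g) \<in> F" "initial_monomials n w (translate I h) \<in> F"
      using g(1) h(1) by (auto simp: F_def)
    ultimately show ?thesis by (intro D[THEN bspec, THEN bspec, THEN mp]) simp_all
  qed
  from P nonzero const show ?thesis by (rule that)
qed

end

theorem proposition3p1:
  fixes smul :: "'k::{alg_closed_field, field_char_0} \<Rightarrow> 'v::ab_group_add \<Rightarrow> 'v"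
    and n :: nat
    and x :: "nat \<Rightarrow> 'v \<Rightarrow> 'k"
    and I :: "'k mpoly set"
  assumes "\<exists>B. finite_dimensional_vector_space smul B"
    and "basis_of_dual smul n x"
    and "graded_ideal n I"
  shows "\<exists>U. openin (zariski_GL smul) U \<and>
             zariski_GL smul closure_of U = topspace (zariski_GL smul) \<and>
             (\<forall>g\<in>U. \<forall>h\<in>U. groebner_fan n (GL_act n x g ` I) = groebner_fan n (GL_act n x h ` I))"
proof -
  obtain B where B: "finite_dimensional_vector_space smul B" using assms(1) by blast
  interpret dual_coordinates smul B n x
    by (rule dual_coordinates.intro[OF B]) (unfold_locales, rule assms(2))
  interpret I: graded_polynomial_ideal n I by (rule graded_polynomial_idealI[OF assms(3)])
  have inf: "infinite (UNIV :: 'k set)" by (rule infinite_UNIV_char_0)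
  obtain p where p: "p \<in> polynomial_functions smul" "\<exists>g\<in>GL smul. p g \<noteq> 0"
    "\<And>g h w. g \<in> GL smul \<Longrightarrow> p g \<noteq> 0 \<Longrightarrow> h \<in> GL smul \<Longrightarrow> p h \<noteq> 0 \<Longrightarrow>
      initial_monomials n w (translate I g) = initial_monomials n w (translate I h)"
    by (rule generic_initial_monomials[OF inf I.graded_polynomial_ideal_axioms], rule that)
  have image: "GL_act n x g ` I = translate I g" if "g \<in> GL smul" for g
    unfolding translate_def by (rule GL_act_image[OF that I.subset_polys])
  show ?thesis
  proof (intro exI[of _ "{g \<in> GL smul. p g \<noteq> 0}"] conjI ballI)
    fix g h assume "g \<in> {g \<in> GL smul. p g \<noteq> 0}" "h \<in> {g \<in> GL smul. p g \<noteq> 0}"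
    then have g: "g \<in> GL smul" "p g \<noteq> 0" and h: "h \<in> GL smul" "p h \<noteq> 0" by simp_all
    show "groebner_fan n (GL_act n x g ` I) = groebner_fan n (GL_act n x h ` I)"
      unfolding image[OF g(1)] image[OF h(1)] by (rule groebner_fan_cong[OF p(3)[OF g h]])
  qed (rule principal_open_dense[OF inf p(1,2)])+
qed

end
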